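(* Let $f:X\to Y$ be a continuous surjective map between compact Hausdorff spaces. Then the map $Hf:HX\to HY$ is open if and only if $f$ is open.
   Context: For a compact Hausdorff space $X$, let $HM(X)$ be the set of all maps $\alpha:[0,1)\to X$ for which there exist $0=t_0<t_1<\dots<t_n=1$ such that $\alpha$ is constant on each $[t_i,t_{i+1})$. Let $C(X)$ be the set of continuous real-valued functions on $X$. For $\varphi\in C(X)$ and $0\le a<b\le 1$ define $\varphi_{(a,b)}:HM(X)\to\mathbb{R}$ by $\varphi_{(a,b)}(\alpha)=\frac{1}{b-a}\int_a^b\varphi(\alpha(t))\,dt$, and let $S_{HM}(X)$ be the set of all such functions. The map $\alpha\mapsto(\varphi_{(a,b)}(\alpha))_{\varphi_{(a,b)}\in S_{HM}(X)}$ embeds $HM(X)$ into the product $\prod_{\varphi_{(a,b)}\in S_{HM}(X)}[\min\varphi,\max\varphi]$ (product topology); $HX$ is the closure of the image of $HM(X)$ in this product (a compact Hausdorff space), and $p_{\varphi_{(a,b)}}:HX\to\mathbb{R}$ denotes the restriction of the coordinate projection. For a continuous map $f:X\to Y$, $Hf:HX\to HY$ is the unique continuous map with $p_{\varphi_{(a,b)}}\circ Hf=p_{(\varphi\circ f)_{(a,b)}}$ for all $\varphi\in C(Y)$ and $0\le a<b\le 1$; it extends $\alpha\mapsto f\circ\alpha$ on $HM(X)$. *)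

theory Defs
  imports "HOL-Analysis.Analysis"
begin

definition HM :: "'a topology \<Rightarrow> (real \<Rightarrow> 'a) set" where
  "HM X = {\<alpha>. (\<forall>t\<in>{0..<1}. \<alpha> t \<in> topspace X) \<and> (\<forall>t. t \<notin> {0..<1} \<longrightarrow> \<alpha> t = undefined) \<and>
     (\<exists>n::nat. \<exists>ts::nat \<Rightarrow> real. ts 0 = 0 \<and> ts n = 1 \<and> (\<forall>i<n. ts i < ts (Suc i)) \<and>
        (\<forall>i<n. \<forall>t\<in>{ts i..<ts (Suc i)}. \<alpha> t = \<alpha> (ts i)))}"

definition HM_fun :: "'a topology \<Rightarrow> ('a \<Rightarrow> real) \<Rightarrow> real \<Rightarrow> real \<Rightarrow> (real \<Rightarrow> 'a) \<Rightarrow> real" where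
  "HM_fun X \<phi> a b = (\<lambda>\<alpha>\<in>HM X. (1 / (b - a)) * integral {a..b} (\<lambda>t. \<phi> (\<alpha> t)))"

definition SHM :: "'a topology \<Rightarrow> ((real \<Rightarrow> 'a) \<Rightarrow> real) set" where
  "SHM X = {HM_fun X \<phi> a b | \<phi> a b. continuous_map X euclideanreal \<phi> \<and> 0 \<le> a \<and> a < b \<and> b \<le> 1}"

text \<open>The coordinate interval [min phi, max phi] for s = phi_(a,b)
  (independent of the chosen representative phi, since phi = s on constant maps).\<close>
definition Hcoord_range :: "'a topology \<Rightarrow> ((real \<Rightarrow> 'a) \<Rightarrow> real) \<Rightarrow> real set" where
  "Hcoord_range X s =
     (let \<phi> = (SOME \<phi>. \<exists>a b. continuous_map X euclideanreal \<phi> \<and> 0 \<le> a \<and> a < b \<and> b \<le> 1 \<and>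
                          s = HM_fun X \<phi> a b)
      in {Inf (\<phi> ` topspace X) .. Sup (\<phi> ` topspace X)})"

definition Hprod :: "'a topology \<Rightarrow> (((real \<Rightarrow> 'a) \<Rightarrow> real) \<Rightarrow> real) topology" where
  "Hprod X = product_topology (\<lambda>s. subtopology euclideanreal (Hcoord_range X s)) (SHM X)"

definition Hembed :: "'a topology \<Rightarrow> (real \<Rightarrow> 'a) \<Rightarrow> ((real \<Rightarrow> 'a) \<Rightarrow> real) \<Rightarrow> real" where
  "Hembed X \<alpha> = (\<lambda>s\<in>SHM X. s \<alpha>)"

definition HX :: "'a topology \<Rightarrow> (((real \<Rightarrow> 'a) \<Rightarrow> real) \<Rightarrow> real) topology" where
  "HX X = subtopology (Hprod X) (Hprod X closure_of (Hembed X ` HM X))"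

text \<open>Hf: the unique continuous map HX -> HY with p_{psi_(a,b)} o Hf = p_{(psi o f)_(a,b)}
  (taken extensional on topspace (HX X) so that it is unique as a HOL function).\<close>
definition Hmap :: "'a topology \<Rightarrow> 'b topology \<Rightarrow> ('a \<Rightarrow> 'b)
     \<Rightarrow> (((real \<Rightarrow> 'a) \<Rightarrow> real) \<Rightarrow> real) \<Rightarrow> (((real \<Rightarrow> 'b) \<Rightarrow> real) \<Rightarrow> real)" where
  "Hmap X Y f = (THE g. g \<in> extensional (topspace (HX X)) \<and> continuous_map (HX X) (HX Y) g \<and>
     (\<forall>\<psi> a b. continuous_map Y euclideanreal \<psi> \<and> 0 \<le> a \<and> a < b \<and> b \<le> 1 \<longrightarrow>
        (\<forall>z\<in>topspace (HX X). g z (HM_fun Y \<psi> a b) = z (HM_fun X (\<psi> \<circ> f) a b))))"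

end

theory Submission
  imports Defs
begin

text \<open>
  If \<open>f\<close> is open, then for every continuous \<open>g\<close> on \<open>X\<close> the fibrewise maximum of \<open>g\<close> is a continuous
  function on \<open>Y\<close>. Fix \<open>z\<close> in \<open>HX\<close> and finitely many coordinates. For a step function \<open>\<beta>\<close> in \<open>HM Y\<close>, the
  coordinate vectors of the step functions over \<open>\<beta>\<close> form a convex set (two of them are mixed by
  alternating between them in a prescribed proportion on each common interval of constancy), and the
  support function of this set is the integral of fibrewise maxima along \<open>\<beta>\<close>. If \<open>\<beta>\<close> is close to
  \<open>Hf z\<close>, these integrals are, for a finite net of directions, almost as large as the pairing of the
  direction with the coordinates of \<open>z\<close>, so by a Hilbert space projection argument the convex set
  comes close to the coordinates of \<open>z\<close>. Density of \<open>HM Y\<close> and compactness of \<open>HX\<close> then give openness.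

  Conversely, a Urysohn function \<open>\<phi>\<close> for a point and its neighbourhood \<open>U\<close> cuts out the open set of
  those \<open>z\<close> whose mean of \<open>\<phi>\<close> exceeds 1/2. Restricting its image under \<open>Hf\<close> to constant maps gives
  an open set of points \<open>y\<close>, and each of their fibres meets \<open>U\<close>.
\<close>

section \<open>Step functions\<close>

text \<open>\<open>S\<close> holds every point at which \<open>h\<close> may jump. The tested
  interval is open at \<open>t\<close> and closed at \<open>u\<close>, so a jump takes effect at the
  breakpoint itself and the pieces are closed on the left, as in \<open>HM\<close>. With an
  unordered set, several functions get common breakpoints by taking unions.\<close>

definition step_on :: "real set \<Rightarrow> (real \<Rightarrow> 'c) \<Rightarrow> bool" where
  "step_on S h \<longleftrightarrow> (\<forall>t u. t < u \<and> S \<inter> {t<..u} = {} \<longrightarrow> h t = h u)"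

lemma step_onD: "step_on S h \<Longrightarrow> t \<le> u \<Longrightarrow> S \<inter> {t<..u} = {} \<Longrightarrow> h u = h t"
  unfolding step_on_def by (metis order_le_less)

lemma step_on_mono: "step_on S h \<Longrightarrow> S \<subseteq> T \<Longrightarrow> step_on T h"
  unfolding step_on_def by blast

lemma step_on_const: "step_on S (\<lambda>t. c)"
  by (simp add: step_on_def)

lemma step_on_compose: "step_on S h \<Longrightarrow> step_on S (\<lambda>t. k (h t))"
  unfolding step_on_def by metis

lemma step_on_compose2: "step_on S h \<Longrightarrow> step_on S h' \<Longrightarrow> step_on S (\<lambda>t. k (h t) (h' t))"
  unfolding step_on_def by metis

lemma step_on_if:
  "step_on S p \<Longrightarrow> step_on S h \<Longrightarrow> step_on S h' \<Longrightarrow> step_on S (\<lambda>t. if p t then h t else h' t)"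
  unfolding step_on_def by metis

lemma step_on_less: "step_on {c} (\<lambda>t. t < c)"
  unfolding step_on_def by force

lemma step_on_Ico: "step_on {a, b} (\<lambda>t. t \<in> {a..<b})"
  unfolding step_on_def by force

text \<open>Induction on the number of breakpoints strictly inside the interval, splitting at one of
  them. Statements about integrals of step functions thus reduce to a cell without inner breakpoints
  and to additivity.\<close>

lemma breakpoint_induct [consumes 2, case_names cell join]:
  fixes a b :: real
  assumes "finite S" "a < b"
    and cell: "\<And>a b. a < b \<Longrightarrow> S \<inter> {a<..<b} = {} \<Longrightarrow> P a b"
    and join: "\<And>a c b. a < c \<Longrightarrow> c < b \<Longrightarrow> P a c \<Longrightarrow> P c b \<Longrightarrow> P a b"
  shows "P a b"
  using \<open>a < b\<close>
proof (induction "card (S \<inter> {a<..<b})" arbitrary: a b rule: less_induct)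
  case less
  show ?case
  proof (cases "S \<inter> {a<..<b} = {}")
    case True
    then show ?thesis using cell less.prems by blast
  next
    case False
    then obtain c where c: "c \<in> S" "a < c" "c < b" by auto
    have "S \<inter> {a<..<c} \<subset> S \<inter> {a<..<b}" "S \<inter> {c<..<b} \<subset> S \<inter> {a<..<b}"
      using c by auto
    then have "card (S \<inter> {a<..<c}) < card (S \<inter> {a<..<b})"
      "card (S \<inter> {c<..<b}) < card (S \<inter> {a<..<b})"
      using \<open>finite S\<close> by (auto intro!: psubset_card_mono)
    then show ?thesis using less.hyps c join by blast
  qed
qed

lemma step_on_cell:
  assumes "step_on S h" "S \<inter> {a<..<b} = {}" "t \<in> {a..<b}"
  shows "h t = h a"
  by (rule step_onD[OF assms(1)]) (use assms in force)+

section \<open>Integrals of step functions over half-open intervals\<close>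

lemma has_integral_Ico_iff_Icc:
  fixes h :: "real \<Rightarrow> real"
  shows "(h has_integral I) {a..<b} \<longleftrightarrow> (h has_integral I) {a..b}"
  by (rule has_integral_spike_set_eq; rule negligible_subset[of "{b}"]) (auto simp: negligible_sing)

lemma integral_Ico_eq_Icc:
  fixes h :: "real \<Rightarrow> real"
  shows "integral {a..<b} h = integral {a..b} h"
  unfolding integral_def integrable_on_def has_integral_Ico_iff_Icc ..

lemma has_integral_const_Ico:
  assumes "a \<le> b" "\<And>t. t \<in> {a..<b} \<Longrightarrow> h t = (c::real)"
  shows "(h has_integral (b - a) * c) {a..<b}"
proof -
  have "((\<lambda>t. c) has_integral (b - a) * c) {a..<b}"
    using has_integral_const_real[of c a b] assms(1) by (simp add: has_integral_Ico_iff_Icc)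
  then show ?thesis
    using has_integral_cong[of "{a..<b}" h "\<lambda>t. c"] assms(2) by metis
qed

lemma has_integral_join_Ico:
  fixes h :: "real \<Rightarrow> real"
  assumes "a \<le> c" "c \<le> b" "(h has_integral I) {a..<c}" "(h has_integral J) {c..<b}"
  shows "(h has_integral I + J) {a..<b}"
  using assms has_integral_combine unfolding has_integral_Ico_iff_Icc by blast

lemma step_on_integrable:
  fixes h :: "real \<Rightarrow> real"
  assumes "finite S" "step_on S h"
  shows "h integrable_on {a..<b}"
proof (cases "a < b")
  case True
  with assms(1) show ?thesis
  proof (induction rule: breakpoint_induct)
    case (cell a b)
    then show ?case
      using has_integral_const_Ico[of a b h "h a"] step_on_cell[OF assms(2)]
      by (metis has_integral_integrable less_imp_le)
  next
    case (join a c b)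
    then show ?case
      using has_integral_join_Ico[of a c b h] unfolding integrable_on_def by (meson less_imp_le)
  qed
qed auto

lemma step_on_integral_join:
  fixes h :: "real \<Rightarrow> real"
  assumes "finite S" "step_on S h" "a \<le> c" "c \<le> b"
  shows "integral {a..<b} h = integral {a..<c} h + integral {c..<b} h"
  using has_integral_join_Ico[OF assms(3,4)] step_on_integrable[OF assms(1,2)]
  by (meson integrable_integral integral_unique)

text \<open>On every cell of \<open>S\<close> keep the initial part of relative length
  \<open>s\<close>: functions constant on the cells then keep exactly the share \<open>s\<close> of
  their integral. One \<open>\<kappa>\<close> serves all \<open>h\<close> with breakpoints in
  \<open>S\<close>, which makes mixtures exact in finitely many coordinates at once.\<close>

lemma thin_indicator_exists:
  assumes "finite S" "0 \<le> s" "s \<le> (1::real)" "a < b"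
  shows "\<exists>\<kappa> T. finite T \<and> step_on T \<kappa> \<and>
    (\<forall>h :: real \<Rightarrow> real. step_on S h \<longrightarrow>
       integral {a..<b} (\<lambda>t. if \<kappa> t then h t else 0) = s * integral {a..<b} h)"
  using assms(1,4)
proof (induction rule: breakpoint_induct)
  case (cell a b)
  define e where "e = a + s * (b - a)"
  have "0 \<le> s * (b - a)" "s * (b - a) \<le> b - a"
    using mult_left_le_one_le[of "b - a" s] assms(2,3) cell(1) by auto
  then have e: "a \<le> e" "e \<le> b" by (auto simp: e_def)
  have "integral {a..<b} (\<lambda>t. if t < e then h t else 0) = s * integral {a..<b} h"
    if h: "step_on S h" for h :: "real \<Rightarrow> real"
  proof -
    have c: "h t = h a" if "t \<in> {a..<b}" for t
      using step_on_cell[OF h] cell that by metis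
    have "((\<lambda>t. if t < e then h t else 0) has_integral (e - a) * h a) {a..<e}"
      by (rule has_integral_const_Ico) (use e in \<open>auto intro!: c\<close>)
    moreover have "((\<lambda>t. if t < e then h t else 0) has_integral (b - e) * 0) {e..<b}"
      by (rule has_integral_const_Ico) (use e in auto)
    ultimately have "((\<lambda>t. if t < e then h t else 0) has_integral (e - a) * h a + (b - e) * 0) {a..<b}"
      by (rule has_integral_join_Ico[OF e])
    moreover have "(h has_integral (b - a) * h a) {a..<b}"
      by (rule has_integral_const_Ico) (use cell in \<open>auto intro!: c\<close>)
    ultimately show ?thesis by (simp add: integral_unique e_def)
  qed
  then show ?case using step_on_less[of e] by (meson finite.emptyI finite.insertI)
next
  case (join a c b)
  then obtain \<kappa>1 T1 \<kappa>2 T2 where 1: "finite T1" "step_on T1 \<kappa>1" and 2: "finite T2" "step_on T2 \<kappa>2"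
    and i1: "\<And>h :: real \<Rightarrow> real. step_on S h \<Longrightarrow>
       integral {a..<c} (\<lambda>t. if \<kappa>1 t then h t else 0) = s * integral {a..<c} h"
    and i2: "\<And>h :: real \<Rightarrow> real. step_on S h \<Longrightarrow>
       integral {c..<b} (\<lambda>t. if \<kappa>2 t then h t else 0) = s * integral {c..<b} h"
    by (elim exE conjE) blast
  define \<kappa> where "\<kappa> t = (if t < c then \<kappa>1 t else \<kappa>2 t)" for t
  \<comment> \<open>The point \<open>c\<close> becomes a breakpoint because \<open>\<kappa>\<close>
    passes from \<open>\<kappa>1\<close> to \<open>\<kappa>2\<close> there.\<close>
  define T where "T = insert c (T1 \<union> T2)"
  have T: "finite T" using 1 2 by (auto simp: T_def)
  have st: "step_on T (\<lambda>t. t < c)" "step_on T \<kappa>1" "step_on T \<kappa>2"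
    using 1 2 step_on_less[of c] by (auto simp: T_def elim: step_on_mono)
  have \<kappa>: "step_on T \<kappa>"
    unfolding \<kappa>_def[abs_def] by (rule step_on_if[OF st])
  have "integral {a..<b} (\<lambda>t. if \<kappa> t then h t else 0) = s * integral {a..<b} h"
    if h: "step_on S h" for h :: "real \<Rightarrow> real"
  proof -
    have fin: "finite (S \<union> T)" using assms T by auto
    have hh: "step_on (S \<union> T) h" "step_on (S \<union> T) \<kappa>" using h \<kappa> by (auto elim: step_on_mono)
    have "step_on (S \<union> T) (\<lambda>t. if \<kappa> t then h t else 0)"
      by (rule step_on_if[OF hh(2,1) step_on_const])
    note j = step_on_integral_join[OF fin this, of a c b] step_on_integral_join[OF fin hh(1), of a c b]
    have "integral {a..<c} (\<lambda>t. if \<kappa> t then h t else 0) = integral {a..<c} (\<lambda>t. if \<kappa>1 t then h t else 0)"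
      "integral {c..<b} (\<lambda>t. if \<kappa> t then h t else 0) = integral {c..<b} (\<lambda>t. if \<kappa>2 t then h t else 0)"
      by (auto intro!: integral_cong simp: \<kappa>_def)
    then show ?thesis using j i1[OF h] i2[OF h] join(1,2) by (simp add: algebra_simps)
  qed
  then show ?case using T \<kappa> by blast
qed

text \<open>Replaces the ordered partition by a finite breakpoint set. One direction locates the
  cell of a given time, the other concatenates partitions along
  \<open>breakpoint_induct\<close>.\<close>

lemma HM_iff:
  "\<alpha> \<in> HM X \<longleftrightarrow> (\<forall>t\<in>{0..<1}. \<alpha> t \<in> topspace X) \<and> (\<forall>t. t \<notin> {0..<1} \<longrightarrow> \<alpha> t = undefined) \<and>
     (\<exists>S. finite S \<and> step_on S \<alpha>)" (is "_ \<longleftrightarrow> ?A \<and> ?B \<and> ?C")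
proof
  assume "\<alpha> \<in> HM X"
  then obtain n ts where AB: ?A ?B and ts: "ts 0 = 0" "ts n = 1" "\<forall>i<n. ts i < ts (Suc i)"
    and c: "\<forall>i<n. \<forall>t\<in>{ts i..<ts (Suc i)}. \<alpha> t = \<alpha> (ts i)"
    unfolding HM_def by auto
  \<comment> \<open>The points \<open>ts 0 = 0\<close> and \<open>ts n = 1\<close> count as
    breakpoints: they separate \<open>{0..<1}\<close> from the outside, where the value is
    \<open>undefined\<close>.\<close>
  have "step_on (ts ` {..n}) \<alpha>"
    unfolding step_on_def
  proof (intro allI impI, elim conjE)
    fix t u :: real assume tu: "t < u" "ts ` {..n} \<inter> {t<..u} = {}"
    then have no: "ts i \<le> t \<or> u < ts i" if "i \<le> n" for i using that by force
    show "\<alpha> t = \<alpha> u"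
    proof (cases "0 \<le> t \<and> t < 1")
      case False
      then have "t \<notin> {0..<1}" "u \<notin> {0..<1}" using no[of 0] no[of n] ts tu by auto
      then show ?thesis using AB by metis
    next
      case True
      \<comment> \<open>The least partition point beyond \<open>t\<close> is the right end of the
        cell of \<open>t\<close>. As no partition point lies in \<open>{t<..u}\<close>,
        \<open>u\<close> is in the same cell.\<close>
      define i where "i = (LEAST i. t < ts i)"
      have "t < ts n" using True ts by simp
      then have i: "t < ts i" "i \<le> n" and least: "\<And>j. j < i \<Longrightarrow> \<not> t < ts j"
        unfolding i_def by (auto intro: LeastI Least_le dest: not_less_Least)
      have "i \<noteq> 0" using i ts True by (intro notI) auto
      then obtain j where j: "i = Suc j" using not0_implies_Suc by blast
      have "ts j \<le> t" using least[of j] j by auto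
      moreover have "u < ts (Suc j)" using no[OF i(2)] i j by auto
      ultimately have "\<alpha> t = \<alpha> (ts j)" "\<alpha> u = \<alpha> (ts j)" using c i j tu by auto
      then show ?thesis by simp
    qed
  qed
  then show "?A \<and> ?B \<and> ?C" using AB by blast
next
  assume R: "?A \<and> ?B \<and> ?C"
  then obtain S where S: "finite S" "step_on S \<alpha>" by blast
  have "\<exists>n::nat. \<exists>ts::nat \<Rightarrow> real. ts 0 = a \<and> ts n = b \<and> (\<forall>i<n. ts i < ts (Suc i)) \<and>
        (\<forall>i<n. \<forall>t\<in>{ts i..<ts (Suc i)}. \<alpha> t = \<alpha> (ts i))" if "a < b" for a b
    using S(1) that
  proof (induction rule: breakpoint_induct)
    case (cell a b)
    then show ?case
      by (intro exI[of _ 1] exI[of _ "\<lambda>i. if i = 0 then a else b"])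
        (auto intro: step_on_cell[OF S(2)])
  next
    case (join a c b)
    from join(3) obtain n ts where n: "ts 0 = a" "ts n = c" "\<forall>i<n. ts i < ts (Suc i)"
        "\<forall>i<n. \<forall>t\<in>{ts i..<ts (Suc i)}. \<alpha> t = \<alpha> (ts i)"
      by (elim exE conjE) (rule that)
    from join(4) obtain m us where m: "us 0 = c" "us m = b" "\<forall>i<m. us i < us (Suc i)"
        "\<forall>i<m. \<forall>t\<in>{us i..<us (Suc i)}. \<alpha> t = \<alpha> (us i)"
      by (elim exE conjE) (rule that)
    \<comment> \<open>Index \<open>n\<close> is already read from \<open>us\<close>; this agrees
      with \<open>ts\<close> because \<open>ts n = us 0 = c\<close>.\<close>
    define vs where "vs i = (if i < n then ts i else us (i - n))" for i
    have lo: "vs i = ts i" "vs (Suc i) = ts (Suc i)" if "i < n" for i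
      using that n(1,2) m(1) by (cases "Suc i = n"; simp add: vs_def)+
    have hi: "vs i = us (i - n)" "vs (Suc i) = us (Suc (i - n))" "i - n < m" if "\<not> i < n" "i < n + m" for i
      using that by (auto simp: vs_def Suc_diff_le)
    show ?case
    proof (intro exI[of _ "n + m"] exI[of _ vs] conjI allI impI)
      show "vs 0 = a" using n(1,2) m(1) by (cases n) (auto simp: vs_def)
      show "vs (n + m) = b" using m(2) by (auto simp: vs_def)
      show "vs i < vs (Suc i)" if "i < n + m" for i
        using n(3) m(3) lo hi that by (cases "i < n") auto
      show "\<forall>t\<in>{vs i..<vs (Suc i)}. \<alpha> t = \<alpha> (vs i)" if "i < n + m" for i
        using n(4) m(4) lo[of i] hi[of i] that by (cases "i < n") metis+
    qed
  qed
  from this[of 0 1] show "\<alpha> \<in> HM X" using R unfolding HM_def by auto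
qed

lemma HM_E:
  assumes "\<alpha> \<in> HM X"
  obtains S where "finite S" "step_on S \<alpha>" "\<And>t. t \<in> {0..<1} \<Longrightarrow> \<alpha> t \<in> topspace X"
    "\<And>t. t \<notin> {0..<1} \<Longrightarrow> \<alpha> t = undefined"
  using assms unfolding HM_iff by auto

lemma restrict_HM:
  assumes "finite S" "step_on S h" "\<And>t. t \<in> {0..<1} \<Longrightarrow> h t \<in> topspace X"
  shows "restrict h {0..<1} \<in> HM X"
proof -
  have "step_on (S \<union> {0, 1}) (\<lambda>t::real. t \<in> {0..<1})" "step_on (S \<union> {0, 1}) h"
    using assms(2) step_on_Ico[of 0 1] by (auto elim: step_on_mono simp del: atLeastLessThan_iff)
  from step_on_if[OF this step_on_const]
  have "step_on (S \<union> {0, 1}) (\<lambda>t. if t \<in> {0..<1} then h t else undefined)" .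
  then show ?thesis unfolding HM_iff restrict_def using assms by (auto intro!: exI[of _ "S \<union> {0, 1}"])
qed

lemma step_on_eval:
  "step_on S G \<Longrightarrow> step_on T \<alpha> \<Longrightarrow> step_on (S \<union> T) (\<lambda>t. G t (\<alpha> t))"
  by (rule step_on_compose2[of _ G \<alpha> "\<lambda>g x. g x"]) (auto elim: step_on_mono)

lemma HM_fun_has_integral:
  assumes "\<alpha> \<in> HM X" "0 \<le> a" "a < b" "b \<le> 1"
  shows "((\<lambda>t. \<phi> (\<alpha> t)) has_integral (b - a) * HM_fun X \<phi> a b \<alpha>) {a..<b}"
proof -
  obtain S where S: "finite S" "step_on S \<alpha>" using HM_E[OF assms(1)] by metis
  have "(\<lambda>t. \<phi> (\<alpha> t)) integrable_on {a..<b}"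
    by (rule step_on_integrable[OF S(1) step_on_compose[OF S(2)]])
  then show ?thesis
    using assms by (simp add: HM_fun_def integral_Ico_eq_Icc[symmetric] integrable_integral)
qed

lemma HM_fun_const:
  assumes "x \<in> topspace X" "0 \<le> a" "a < b" "b \<le> 1"
  shows "HM_fun X \<phi> a b (\<lambda>t\<in>{0..<1}. x) = \<phi> x"
proof -
  have "(\<lambda>t\<in>{0..<1}. x) \<in> HM X"
    by (rule restrict_HM[where S="{}"]) (use assms step_on_const in auto)
  from HM_fun_has_integral[OF this assms(2-)]
  have "((\<lambda>t. \<phi> ((\<lambda>t\<in>{0..<1}. x) t)) has_integral (b - a) * HM_fun X \<phi> a b (\<lambda>t\<in>{0..<1}. x)) {a..<b}" .
  moreover have "((\<lambda>t. \<phi> ((\<lambda>t\<in>{0..<1}. x) t)) has_integral (b - a) * \<phi> x) {a..<b}"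
    by (rule has_integral_const_Ico) (use assms in auto)
  ultimately show ?thesis using assms by (auto dest: has_integral_unique)
qed

text \<open>Brings coordinates over different intervals to one form: the integrand is
  \<open>\<phi> x / (b - a)\<close> during \<open>{a..<b}\<close> and 0 at other times. Weighted
  sums of coordinates can then be formed under a single integral.\<close>

lemma SHM_integral_representation:
  assumes "s \<in> SHM X"
  obtains S G where "finite S" "step_on S G" "\<And>t. continuous_map X euclideanreal (G t)"
    "\<And>\<alpha>. \<alpha> \<in> HM X \<Longrightarrow> s \<alpha> = integral {0..<1} (\<lambda>t. G t (\<alpha> t))"
proof -
  obtain \<phi> a b where s: "s = HM_fun X \<phi> a b" "continuous_map X euclideanreal \<phi>" "0 \<le> a" "a < b" "b \<le> 1"
    using assms unfolding SHM_def by auto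
  define G where "G = (\<lambda>t x. if t \<in> {a..<b} then \<phi> x / (b - a) else 0)"
  show thesis
  proof (rule that[of "{a, b}" G])
    show "step_on {a, b} G"
      unfolding G_def by (rule step_on_compose[OF step_on_Ico])
    show "continuous_map X euclideanreal (G t)" for t
      using continuous_map_real_mult[OF s(2), of "\<lambda>_. 1 / (b - a)"] by (cases "t \<in> {a..<b}") (simp_all add: G_def)
    show "s \<alpha> = integral {0..<1} (\<lambda>t. G t (\<alpha> t))" if "\<alpha> \<in> HM X" for \<alpha>
    proof -
      have sub: "{a..<b} \<inter> {0..<1} = {a..<b}" using s by auto
      have "integral {0..<1} (\<lambda>t. G t (\<alpha> t)) = integral {a..<b} (\<lambda>t. \<phi> (\<alpha> t) / (b - a))"
        unfolding G_def by (simp only: integral_restrict_Int sub)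
      also have "\<dots> = integral {a..<b} (\<lambda>t. \<phi> (\<alpha> t)) / (b - a)" by simp
      also have "\<dots> = s \<alpha>"
        using HM_fun_has_integral[OF that s(3-), of \<phi>] s by (simp add: integral_unique)
      finally show ?thesis by simp
    qed
  qed auto
qed

text \<open>The interval is defined through a representative picked by \<open>SOME\<close>. That
  representative also computes \<open>s\<close>, so \<open>s \<alpha>\<close> is a mean of its
  values and lies between their infimum and supremum.\<close>

lemma SHM_Hcoord_range:
  assumes "compact_space X" "s \<in> SHM X" "\<alpha> \<in> HM X"
  shows "s \<alpha> \<in> Hcoord_range X s"
proof -
  define \<phi> where "\<phi> = (SOME \<phi>. \<exists>a b. continuous_map X euclideanreal \<phi> \<and> 0 \<le> a \<and> a < b \<and> b \<le> 1 \<and>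
                          s = HM_fun X \<phi> a b)"
  have "\<exists>\<phi>. \<exists>a b. continuous_map X euclideanreal \<phi> \<and> 0 \<le> a \<and> a < b \<and> b \<le> 1 \<and>
                          s = HM_fun X \<phi> a b"
    using assms(2) unfolding SHM_def by auto
  from someI_ex[OF this, folded \<phi>_def] obtain a b
    where \<phi>: "continuous_map X euclideanreal \<phi>" and ab: "0 \<le> a" "a < b" "b \<le> 1" and s: "s = HM_fun X \<phi> a b"
    by blast
  have "compactin euclideanreal (\<phi> ` topspace X)"
    using assms(1) \<phi> image_compactin compact_space_def by blast
  then have bdd: "bdd_above (\<phi> ` topspace X)" "bdd_below (\<phi> ` topspace X)"
    by (auto simp: compact_imp_bounded bounded_imp_bdd_above bounded_imp_bdd_below)
  have "\<alpha> t \<in> topspace X" if "t \<in> {a..<b}" for t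
    using HM_E[OF assms(3)] that ab by (metis atLeastLessThan_iff order.strict_trans2 order.trans)
  then have bounds: "Inf (\<phi> ` topspace X) \<le> \<phi> (\<alpha> t)" "\<phi> (\<alpha> t) \<le> Sup (\<phi> ` topspace X)" if "t \<in> {a..<b}" for t
    using bdd that by (auto intro: cInf_lower cSup_upper)
  note I = HM_fun_has_integral[OF assms(3) ab, of \<phi>]
  have "(b - a) * Inf (\<phi> ` topspace X) \<le> (b - a) * s \<alpha>"
    unfolding s by (rule has_integral_le[OF has_integral_const_Ico I]) (use ab bounds in auto)
  moreover have "(b - a) * s \<alpha> \<le> (b - a) * Sup (\<phi> ` topspace X)"
    unfolding s by (rule has_integral_le[OF I has_integral_const_Ico]) (use ab bounds in auto)
  ultimately show ?thesis
    unfolding Hcoord_range_def Let_def \<phi>_def[symmetric] using ab by simp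
qed

section \<open>The space $HX$ and the map $Hf$\<close>

lemma Hprod_eq_subtopology:
  "Hprod X = subtopology (product_topology (\<lambda>s. euclideanreal) (SHM X)) (PiE (SHM X) (Hcoord_range X))"
  unfolding Hprod_def by (simp add: subtopology_product_topology)

lemma compact_space_Hprod: "compact_space (Hprod X)"
proof -
  have "compact (Hcoord_range X s)" for s by (simp add: Hcoord_range_def Let_def)
  then show ?thesis
    unfolding Hprod_def by (auto simp: compact_space_product_topology compact_space_subtopology)
qed

lemma Hausdorff_space_HX: "Hausdorff_space (HX X)"
  unfolding HX_def Hprod_def
  by (intro Hausdorff_space_subtopology) (simp add: Hausdorff_space_product_topology Hausdorff_space_subtopology)

lemma compact_space_HX: "compact_space (HX X)"
  unfolding HX_def
  by (intro compact_space_subtopology closedin_compact_space[OF compact_space_Hprod] closedin_closure_of)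

text \<open>The box of coordinate intervals is closed in the product of real lines and contains the
  embedded step functions, so both closures agree. Later arguments can work in the plain
  product.\<close>

lemma HX_eq_subtopology:
  assumes "compact_space X"
  shows "HX X = subtopology (product_topology (\<lambda>s. euclideanreal) (SHM X))
    (product_topology (\<lambda>s. euclideanreal) (SHM X) closure_of (Hembed X ` HM X))"
proof -
  let ?P = "product_topology (\<lambda>s. euclideanreal) (SHM X)"
  let ?B = "PiE (SHM X) (Hcoord_range X)"
  have "closedin ?P ?B"
    unfolding closedin_product_topology by (auto simp: Hcoord_range_def Let_def)
  moreover have A: "Hembed X ` HM X \<subseteq> ?B"
    using SHM_Hcoord_range[OF assms] by (auto simp: Hembed_def)
  ultimately have C: "?P closure_of (Hembed X ` HM X) \<subseteq> ?B" by (rule closure_of_minimal[rotated])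
  then have "subtopology ?P ?B closure_of (Hembed X ` HM X) = ?P closure_of (Hembed X ` HM X)"
    using A by (auto simp: closure_of_subtopology Int_absorb1)
  then show ?thesis
    using C unfolding HX_def Hprod_eq_subtopology by (simp add: subtopology_subtopology Int_absorb1)
qed

lemma topspace_HX:
  assumes "compact_space X"
  shows "topspace (HX X) = product_topology (\<lambda>s. euclideanreal) (SHM X) closure_of (Hembed X ` HM X)"
  unfolding HX_eq_subtopology[OF assms] by (simp add: closure_of_subset_topspace Int_absorb1 flip: topspace_product_topology)

lemma Hembed_in_HX:
  assumes "compact_space X" "\<alpha> \<in> HM X"
  shows "Hembed X \<alpha> \<in> topspace (HX X)"
proof -
  have "Hembed X ` HM X \<subseteq> topspace (product_topology (\<lambda>s. euclideanreal) (SHM X))"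
    by (auto simp: Hembed_def)
  from closure_of_subset[OF this] show ?thesis
    unfolding topspace_HX[OF assms(1)] using assms(2) by blast
qed

lemma HX_dense:
  assumes "compact_space X"
  shows "HX X closure_of (Hembed X ` HM X) = topspace (HX X)"
proof -
  have "Hembed X ` HM X \<subseteq> topspace (HX X)" using Hembed_in_HX[OF assms] by auto
  then show ?thesis
    unfolding topspace_HX[OF assms] by (simp add: HX_eq_subtopology[OF assms] closure_of_subtopology Int_absorb1)
qed

lemma HX_extensional: "z \<in> topspace (HX X) \<Longrightarrow> z \<in> extensional (SHM X)"
  by (auto simp: HX_def Hprod_def PiE_def)

lemma HX_range: "z \<in> topspace (HX X) \<Longrightarrow> s \<in> SHM X \<Longrightarrow> z s \<in> Hcoord_range X s"
  by (auto simp: HX_def Hprod_def PiE_def)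

lemma continuous_map_HX_eval:
  assumes "compact_space X" "s \<in> SHM X"
  shows "continuous_map (HX X) euclideanreal (\<lambda>z. z s)"
  unfolding HX_eq_subtopology[OF assms(1)]
  by (intro continuous_map_from_subtopology continuous_map_product_projection assms)

text \<open>The set where \<open>h - g\<close> is non-negative is closed and contains the dense
  embedded step functions. Inequalities between integrals thereby reach points of
  \<open>HX X\<close> that come from no step function.\<close>

lemma HX_le_by_density:
  assumes "compact_space X" and g: "continuous_map (HX X) euclideanreal g"
    and h: "continuous_map (HX X) euclideanreal h"
    and le: "\<And>\<alpha>. \<alpha> \<in> HM X \<Longrightarrow> g (Hembed X \<alpha>) \<le> h (Hembed X \<alpha>)"
    and z: "z \<in> topspace (HX X)"
  shows "g z \<le> h z"
proof -
  have "closedin (HX X) {z \<in> topspace (HX X). h z - g z \<in> {0..}}"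
    by (rule closedin_continuous_map_preimage[where Y=euclideanreal]) (auto intro: continuous_map_diff g h)
  then have "HX X closure_of (Hembed X ` HM X) \<subseteq> {z \<in> topspace (HX X). h z - g z \<in> {0..}}"
    using le Hembed_in_HX[OF assms(1)] by (intro closure_of_minimal) auto
  then show ?thesis using z unfolding HX_dense[OF assms(1)] by auto
qed

lemma HX_neighbourhood:
  assumes "compact_space X" "openin (HX X) W" "z0 \<in> W"
  obtains I \<epsilon> where "finite I" "I \<subseteq> SHM X" "\<epsilon> > (0::real)"
    "\<And>z. z \<in> topspace (HX X) \<Longrightarrow> (\<And>s. s \<in> I \<Longrightarrow> \<bar>z s - z0 s\<bar> < \<epsilon>) \<Longrightarrow> z \<in> W"
proof -
  let ?P = "product_topology (\<lambda>s. euclideanreal) (SHM X)"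
  have z0: "z0 \<in> topspace (HX X)" using assms openin_subset by blast
  obtain T where T: "openin ?P T" "W = T \<inter> topspace (HX X)"
    using assms(2) unfolding HX_eq_subtopology[OF assms(1)] openin_subtopology
    by (auto simp: closure_of_subset_topspace Int_absorb1 simp flip: topspace_product_topology)
  then obtain U where U: "finite {s \<in> SHM X. U s \<noteq> UNIV}" "\<And>s. s \<in> SHM X \<Longrightarrow> open (U s)"
    "z0 \<in> PiE (SHM X) U" "PiE (SHM X) U \<subseteq> T"
    using assms(3) unfolding openin_product_topology_alt by auto
  define I where "I = {s \<in> SHM X. U s \<noteq> UNIV}"
  have "\<exists>e>0. \<forall>y. \<bar>y - z0 s\<bar> < e \<longrightarrow> y \<in> U s" if "s \<in> I" for s
    using U(2)[of s] U(3) that unfolding I_def open_dist dist_real_def by (auto simp: PiE_iff)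
  then obtain e where e: "\<And>s. s \<in> I \<Longrightarrow> e s > 0" "\<And>s y. s \<in> I \<Longrightarrow> \<bar>y - z0 s\<bar> < e s \<Longrightarrow> y \<in> U s"
    by metis
  \<comment> \<open>The 1 keeps the minimum defined and positive when \<open>I\<close> is
    empty.\<close>
  define \<epsilon> where "\<epsilon> = Min (insert 1 (e ` I))"
  have fin: "finite I" using U(1) by (simp add: I_def)
  then have \<epsilon>: "\<epsilon> > 0" "\<And>s. s \<in> I \<Longrightarrow> \<epsilon> \<le> e s" using e(1) by (auto simp: \<epsilon>_def)
  show thesis
  proof (rule that[OF fin _ \<epsilon>(1)])
    show "I \<subseteq> SHM X" by (auto simp: I_def)
    fix z assume z: "z \<in> topspace (HX X)" "\<And>s. s \<in> I \<Longrightarrow> \<bar>z s - z0 s\<bar> < \<epsilon>"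
    have "z s \<in> U s" if "s \<in> SHM X" for s
    proof (cases "s \<in> I")
      case True
      then show ?thesis using z(2)[OF True] \<epsilon>(2)[OF True] e(2)[OF True] by simp
    qed (use that in \<open>auto simp: I_def\<close>)
    then have "z \<in> PiE (SHM X) U" using HX_extensional[OF z(1)] by (auto simp: PiE_def)
    then show "z \<in> W" using U(4) T(2) z(1) by blast
  qed
qed

section \<open>Push-forward of step functions and the explicit form of \<open>Hf\<close>\<close>

definition Hpush :: "('a \<Rightarrow> 'b) \<Rightarrow> (real \<Rightarrow> 'a) \<Rightarrow> real \<Rightarrow> 'b" where
  "Hpush f \<alpha> = (\<lambda>t\<in>{0..<1}. f (\<alpha> t))"

lemma Hpush_in_HM:
  assumes "continuous_map X Y f" "\<alpha> \<in> HM X"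
  shows "Hpush f \<alpha> \<in> HM Y"
proof -
  obtain S where S: "finite S" "step_on S \<alpha>" "\<And>t. t \<in> {0..<1} \<Longrightarrow> \<alpha> t \<in> topspace X"
    using HM_E[OF assms(2)] by metis
  show ?thesis unfolding Hpush_def
    by (rule restrict_HM[OF S(1) step_on_compose[OF S(2)]])
      (use S(3) continuous_map_image_subset_topspace[OF assms(1)] in auto)
qed

lemma HM_fun_Hpush:
  assumes "continuous_map X Y f" "\<alpha> \<in> HM X" "0 \<le> a" "a < b" "b \<le> 1"
  shows "HM_fun Y \<psi> a b (Hpush f \<alpha>) = HM_fun X (\<psi> \<circ> f) a b \<alpha>"
proof -
  have "((\<lambda>t. \<psi> (Hpush f \<alpha> t)) has_integral (b - a) * HM_fun Y \<psi> a b (Hpush f \<alpha>)) {a..<b}"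
    by (rule HM_fun_has_integral[OF Hpush_in_HM[OF assms(1,2)] assms(3-)])
  then have "((\<lambda>t. (\<psi> \<circ> f) (\<alpha> t)) has_integral (b - a) * HM_fun Y \<psi> a b (Hpush f \<alpha>)) {a..<b}"
    by (rule has_integral_eq[rotated]) (use assms in \<open>auto simp: Hpush_def\<close>)
  from has_integral_unique[OF this HM_fun_has_integral[OF assms(2-)]] show ?thesis
    using assms by (simp add: o_def)
qed

text \<open>Acts on a coordinate as a function, not on a triple \<open>\<psi>\<close>,
  \<open>a\<close>, \<open>b\<close>, so no choice of representation is involved.\<close>

definition Hpull :: "'a topology \<Rightarrow> ('a \<Rightarrow> 'b) \<Rightarrow> ((real \<Rightarrow> 'b) \<Rightarrow> real) \<Rightarrow> (real \<Rightarrow> 'a) \<Rightarrow> real" where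
  "Hpull X f s = (\<lambda>\<alpha>\<in>HM X. s (Hpush f \<alpha>))"

lemma Hpull_HM_fun:
  assumes "continuous_map X Y f" "0 \<le> a" "a < b" "b \<le> 1"
  shows "Hpull X f (HM_fun Y \<psi> a b) = HM_fun X (\<psi> \<circ> f) a b"
  unfolding Hpull_def using HM_fun_Hpush[OF assms(1) _ assms(2-)]
  by (auto simp: HM_fun_def restrict_def fun_eq_iff)

lemma Hpull_SHM:
  assumes "continuous_map X Y f" "s \<in> SHM Y"
  shows "Hpull X f s \<in> SHM X"
proof -
  obtain \<psi> a b where s: "s = HM_fun Y \<psi> a b" "continuous_map Y euclideanreal \<psi>" "0 \<le> a" "a < b" "b \<le> 1"
    using assms(2) unfolding SHM_def by auto
  then show ?thesis
    using Hpull_HM_fun[OF assms(1)] continuous_map_compose[OF assms(1) s(2)] unfolding SHM_def by auto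
qed

text \<open>The explicit candidate for \<open>Hmap\<close>: each coordinate of the image is a
  pulled-back coordinate of \<open>z\<close>.\<close>

definition Hlift :: "'a topology \<Rightarrow> 'b topology \<Rightarrow> ('a \<Rightarrow> 'b)
     \<Rightarrow> (((real \<Rightarrow> 'a) \<Rightarrow> real) \<Rightarrow> real) \<Rightarrow> (((real \<Rightarrow> 'b) \<Rightarrow> real) \<Rightarrow> real)" where
  "Hlift X Y f z = (\<lambda>s\<in>SHM Y. z (Hpull X f s))"

lemma Hlift_Hembed:
  assumes "continuous_map X Y f" "\<alpha> \<in> HM X"
  shows "Hlift X Y f (Hembed X \<alpha>) = Hembed Y (Hpush f \<alpha>)"
  unfolding Hlift_def Hembed_def using Hpull_SHM[OF assms(1)] assms(2)
  by (auto simp: restrict_def Hpull_def fun_eq_iff)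

text \<open>Every component is a projection of the product, and embedded step functions go to
  embedded step functions, so closure goes into closure.\<close>

lemma continuous_map_Hlift:
  assumes "compact_space X" "compact_space Y" "continuous_map X Y f"
  shows "continuous_map (HX X) (HX Y) (Hlift X Y f)"
proof -
  let ?P = "product_topology (\<lambda>s. euclideanreal) (SHM X)"
  let ?Q = "product_topology (\<lambda>s. euclideanreal) (SHM Y)"
  have c: "continuous_map ?P ?Q (Hlift X Y f)"
    unfolding continuous_map_componentwise
    using Hpull_SHM[OF assms(3)]
    by (auto simp: Hlift_def intro!: continuous_map_product_projection)
  have "Hlift X Y f ` Hembed X ` HM X \<subseteq> Hembed Y ` HM Y"
    using Hlift_Hembed[OF assms(3)] Hpush_in_HM[OF assms(3)] by auto
  then have "Hlift X Y f ` (?P closure_of (Hembed X ` HM X)) \<subseteq> ?Q closure_of (Hembed Y ` HM Y)"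
    using continuous_map_image_closure_subset[OF c] closure_of_mono by blast
  then show ?thesis
    unfolding HX_eq_subtopology[OF assms(1)] HX_eq_subtopology[OF assms(2)]
    by (intro continuous_map_into_subtopology continuous_map_from_subtopology c) auto
qed

text \<open>The prescribed identities fix every coordinate in \<open>SHM Y\<close>, and points of
  \<open>HX Y\<close> are extensional there, so the \<open>THE\<close> in \<open>Hmap\<close> has
  exactly one candidate. Outside \<open>topspace (HX X)\<close> that candidate takes the default
  value.\<close>

lemma Hmap_eq_Hlift:
  assumes "compact_space X" "compact_space Y" "continuous_map X Y f" "z \<in> topspace (HX X)"
  shows "Hmap X Y f z = Hlift X Y f z"
proof -
  let ?g = "restrict (Hlift X Y f) (topspace (HX X))"
  have "Hmap X Y f = ?g"
    unfolding Hmap_def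
  proof (rule the_equality, intro conjI allI impI ballI; (elim conjE)?)
    show "continuous_map (HX X) (HX Y) ?g"
      using continuous_map_Hlift[OF assms(1-3)] by (rule continuous_map_eq) auto
  next
    fix \<psi> a b z assume "continuous_map Y euclideanreal \<psi>" "0 \<le> a" "a < b" "b \<le> (1::real)" "z \<in> topspace (HX X)"
    then show "?g z (HM_fun Y \<psi> a b) = z (HM_fun X (\<psi> \<circ> f) a b)"
      using Hpull_HM_fun[OF assms(3), of a b \<psi>] by (auto simp: Hlift_def SHM_def)
  next
    fix g assume g: "g \<in> extensional (topspace (HX X))" "continuous_map (HX X) (HX Y) g"
      and e: "\<forall>\<psi> a b. continuous_map Y euclideanreal \<psi> \<and> 0 \<le> a \<and> a < b \<and> b \<le> 1 \<longrightarrow>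
        (\<forall>z\<in>topspace (HX X). g z (HM_fun Y \<psi> a b) = z (HM_fun X (\<psi> \<circ> f) a b))"
    show "g = ?g"
    proof (rule extensionalityI[OF g(1)])
      fix z assume z: "z \<in> topspace (HX X)"
      have "g z = Hlift X Y f z"
      proof (rule extensionalityI[where A="SHM Y"])
        show "g z \<in> extensional (SHM Y)"
          using z g(2) by (intro HX_extensional) (auto simp: continuous_map_def)
        show "Hlift X Y f z \<in> extensional (SHM Y)" by (simp add: Hlift_def)
        fix s assume s: "s \<in> SHM Y"
        then obtain \<psi> a b where "s = HM_fun Y \<psi> a b" "continuous_map Y euclideanreal \<psi>" "0 \<le> a" "a < b" "b \<le> 1"
          unfolding SHM_def by auto
        then show "g z s = Hlift X Y f z s"
          using e z s Hpull_HM_fun[OF assms(3), of a b \<psi>] by (simp add: Hlift_def)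
      qed
      then show "g z = ?g z" using z by simp
    qed simp
  qed simp
  then show ?thesis using assms(4) by simp
qed

section \<open>Openness of $Hf$ for open $f$\<close>

text \<open>
  Minimising the norm over the convex family: at a near-minimiser \<open>u\<close>, moving slightly towards the
  \<open>v\<close> supplied by the last assumption would decrease the norm by a definite amount.
\<close>

lemma small_vector_in_convex_family:
  fixes K :: "('i \<Rightarrow> real) set"
  assumes "K \<noteq> {}" "0 \<le> \<rho>" "\<rho> < \<epsilon>"
    and bound: "\<And>u i. u \<in> K \<Longrightarrow> i \<in> I \<Longrightarrow> \<bar>u i\<bar> \<le> R"
    and mix: "\<And>u v \<tau>. u \<in> K \<Longrightarrow> v \<in> K \<Longrightarrow> 0 \<le> \<tau> \<Longrightarrow> \<tau> \<le> 1 \<Longrightarrow>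
      \<exists>w\<in>K. \<forall>i\<in>I. w i = (1 - \<tau>) * u i + \<tau> * v i"
    and descent: "\<And>u. u \<in> K \<Longrightarrow> \<exists>v\<in>K. (\<Sum>i\<in>I. u i * v i) \<le> \<rho>"
  shows "\<exists>u\<in>K. (\<Sum>i\<in>I. (u i)\<^sup>2) < \<epsilon>"
proof (rule ccontr)
  define d where "d u = (\<Sum>i\<in>I. (u i)\<^sup>2)" for u :: "'i \<Rightarrow> real"
  assume "\<not> ?thesis"
  then have ge: "\<epsilon> \<le> d u" if "u \<in> K" for u using that by (auto simp: d_def not_less)
  \<comment> \<open>A bound for \<open>d u + d v\<close> on all of \<open>K\<close>; the 1 makes it
    positive, so that \<open>\<tau>\<close> may divide by it.\<close>
  define B where "B = 1 + 2 * (\<Sum>i\<in>I. R\<^sup>2)"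
  have B: "B > 0" unfolding B_def by (intro add_pos_nonneg mult_nonneg_nonneg sum_nonneg) auto
  have dB: "2 * d u < B" if "u \<in> K" for u
  proof -
    have "d u \<le> (\<Sum>i\<in>I. R\<^sup>2)" unfolding d_def
      using bound[OF that] by (intro sum_mono) (metis abs_ge_zero power2_abs power_mono)
    then show ?thesis by (simp add: B_def)
  qed
  define \<gamma> where "\<gamma> = \<epsilon> - \<rho>"
  \<comment> \<open>Moving by \<open>\<tau>\<close> lowers \<open>d\<close> by at least
    \<open>2 * \<tau> * \<gamma>\<close> to first order and raises it by at most
    \<open>\<tau> * \<tau> * B \<le> \<tau> * \<gamma>\<close> to second order. A \<open>u\<close>
    within \<open>\<tau> * \<gamma>\<close> of the infimum is therefore pushed below it.\<close>
  define \<tau> where "\<tau> = min 1 (\<gamma> / B)"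
  have \<gamma>: "\<gamma> > 0" using assms(3) by (simp add: \<gamma>_def)
  have \<tau>: "0 < \<tau>" "\<tau> \<le> 1" "\<tau> * B \<le> \<gamma>"
    using \<gamma> B by (auto simp: \<tau>_def min_def field_simps)
  have bdd: "bdd_below (d ` K)" using ge by (meson bdd_belowI2)
  have "Inf (d ` K) < Inf (d ` K) + \<tau> * \<gamma>" using \<tau> \<gamma> by simp
  then obtain u where u: "u \<in> K" "d u < Inf (d ` K) + \<tau> * \<gamma>"
    using assms(1) cInf_lessD[of "d ` K"] by blast
  obtain v where v: "v \<in> K" "(\<Sum>i\<in>I. u i * v i) \<le> \<rho>" using descent[OF u(1)] by blast
  obtain w where w: "w \<in> K" "\<And>i. i \<in> I \<Longrightarrow> w i = (1 - \<tau>) * u i + \<tau> * v i"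
    using mix[OF u(1) v(1), of \<tau>] \<tau> by auto
  \<comment> \<open>Splitting \<open>(1 - \<tau>)\<^sup>2\<close> into \<open>1 - 2 * \<tau>\<close>
    and \<open>\<tau>\<^sup>2\<close> isolates the first-order loss.\<close>
  have "d w = (\<Sum>i\<in>I. (1 - 2 * \<tau>) * (u i)\<^sup>2 + (\<tau>\<^sup>2 * (u i)\<^sup>2 + (2 * \<tau> * (1 - \<tau>)) * (u i * v i) + \<tau>\<^sup>2 * (v i)\<^sup>2))"
    unfolding d_def by (rule sum.cong) (simp_all add: w power2_eq_square algebra_simps)
  also have "\<dots> = (1 - 2 * \<tau>) * d u + (\<tau>\<^sup>2 * d u + (2 * \<tau> * (1 - \<tau>)) * (\<Sum>i\<in>I. u i * v i) + \<tau>\<^sup>2 * d v)"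
    by (simp add: d_def sum.distrib sum_distrib_left)
  finally have dw: "d w = d u - 2 * (\<tau> * d u) + 2 * (\<tau> * ((1 - \<tau>) * (\<Sum>i\<in>I. u i * v i))) + \<tau> * (\<tau> * (d u + d v))"
    by (simp add: power2_eq_square algebra_simps)
  have "(1 - \<tau>) * (\<Sum>i\<in>I. u i * v i) \<le> (1 - \<tau>) * \<rho>"
    using \<tau> v(2) by (intro mult_left_mono) auto
  also have "\<dots> \<le> \<rho>" using \<tau> assms(2) by (simp add: mult_left_le_one_le)
  finally have "\<tau> * ((1 - \<tau>) * (\<Sum>i\<in>I. u i * v i)) \<le> \<tau> * \<rho>"
    using \<tau> by (intro mult_left_mono) auto
  moreover have "\<tau> * \<epsilon> \<le> \<tau> * d u" using \<tau> ge[OF u(1)] by (intro mult_left_mono) auto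
  moreover have "\<tau> * (d u + d v) \<le> \<tau> * B"
    using dB[OF u(1)] dB[OF v(1)] \<tau> by (intro mult_left_mono) auto
  then have "\<tau> * (d u + d v) \<le> \<gamma>" using \<tau>(3) by (rule order_trans)
  then have "\<tau> * (\<tau> * (d u + d v)) \<le> \<tau> * \<gamma>"
    using \<tau>(1) by (intro mult_left_mono) (auto simp del: distrib_left)
  ultimately have "d w < Inf (d ` K)"
    using dw u(2) by (simp add: \<gamma>_def algebra_simps)
  then show False using cInf_lower[OF imageI[OF w(1)] bdd] by simp
qed

text \<open>Coordinatewise choice from a finite \<open>\<delta>\<close>-net of
  \<open>{-R..R}\<close>. Only finitely many directions remain to be controlled, so the conditions
  on them cut out an open set.\<close>

lemma finite_net_of_cube:
  fixes R \<delta> :: real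
  assumes "finite I" "\<delta> > 0"
  obtains \<Lambda> :: "('i \<Rightarrow> real) set" where "finite \<Lambda>"
    "\<And>v. (\<And>i. i \<in> I \<Longrightarrow> \<bar>v i\<bar> \<le> R) \<Longrightarrow> \<exists>l\<in>\<Lambda>. \<forall>i\<in>I. \<bar>l i - v i\<bar> \<le> \<delta>"
proof -
  obtain F where F: "finite F" "{-R..R} \<subseteq> (\<Union>x\<in>F. ball x \<delta>)"
    using compact_eq_totally_bounded[of "{-R..R}"] assms(2) by auto
  show thesis
  proof (rule that[of "PiE I (\<lambda>_. F)"])
    show "finite (PiE I (\<lambda>_. F))" using assms(1) F(1) by (intro finite_PiE) auto
    fix v :: "'i \<Rightarrow> real" assume v: "\<And>i. i \<in> I \<Longrightarrow> \<bar>v i\<bar> \<le> R"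
    have "\<exists>x\<in>F. \<bar>x - v i\<bar> \<le> \<delta>" if "i \<in> I" for i
    proof -
      have "v i \<in> {-R..R}" using v[OF that] by auto
      with F(2) obtain x where "x \<in> F" "v i \<in> ball x \<delta>" by blast
      then show ?thesis by (intro bexI[of _ x]) (auto simp: dist_real_def)
    qed
    then obtain x where x: "\<And>i. i \<in> I \<Longrightarrow> x i \<in> F \<and> \<bar>x i - v i\<bar> \<le> \<delta>" by metis
    then show "\<exists>l\<in>PiE I (\<lambda>_. F). \<forall>i\<in>I. \<bar>l i - v i\<bar> \<le> \<delta>"
      by (intro bexI[of _ "restrict x I"]) auto
  qed
qed

text \<open>Fibres are compact and nonempty, so maxima exist. The set where the maximum exceeds
  \<open>a\<close> is the image of an open set under the open map \<open>f\<close>. The set where it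
  is at least \<open>a\<close> is the image of a closed set, hence closed, since \<open>f\<close>
  goes from a compact to a Hausdorff space. The maximiser \<open>m\<close> is a mere choice;
  continuity is claimed for the maximum alone.\<close>

lemma fibre_maximum_continuous:
  fixes g :: "'a \<Rightarrow> real"
  assumes "compact_space X" "Hausdorff_space Y" "continuous_map X Y f" "f ` topspace X = topspace Y"
    "open_map X Y f" "continuous_map X euclideanreal g"
  obtains m where "\<And>y. y \<in> topspace Y \<Longrightarrow> m y \<in> topspace X" "\<And>y. y \<in> topspace Y \<Longrightarrow> f (m y) = y"
    "\<And>x. x \<in> topspace X \<Longrightarrow> g x \<le> g (m (f x))"
    "continuous_map Y euclideanreal (\<lambda>y. g (m y))"
proof -
  have "\<exists>x\<in>topspace X. f x = y \<and> (\<forall>x'\<in>topspace X. f x' = y \<longrightarrow> g x' \<le> g x)" if y: "y \<in> topspace Y" for y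
  proof -
    have "closedin X {x \<in> topspace X. f x \<in> {y}}"
      by (rule closedin_continuous_map_preimage[OF assms(3)]) (use y assms(2) in \<open>simp add: closedin_Hausdorff_sing_eq\<close>)
    then have "compact (g ` {x \<in> topspace X. f x \<in> {y}})"
      using image_compactin[OF closedin_compact_space[OF assms(1)] assms(6)] by simp
    moreover have "g ` {x \<in> topspace X. f x \<in> {y}} \<noteq> {}"
    proof -
      have "y \<in> f ` topspace X" using y assms(4) by simp
      then show ?thesis by auto
    qed
    ultimately obtain r where "r \<in> g ` {x \<in> topspace X. f x \<in> {y}}" "\<forall>r'\<in>g ` {x \<in> topspace X. f x \<in> {y}}. r' \<le> r"
      using compact_attains_sup by blast
    then show ?thesis by auto
  qed
  then obtain m where m: "\<And>y. y \<in> topspace Y \<Longrightarrow> m y \<in> topspace X \<and> f (m y) = y \<and>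
      (\<forall>x'\<in>topspace X. f x' = y \<longrightarrow> g x' \<le> g (m y))"
    by metis
  have fx: "f x \<in> topspace Y" if "x \<in> topspace X" for x using assms(4) that by auto
  have "openin Y {y \<in> topspace Y. a < g (m y)}" for a
  proof -
    have "{y \<in> topspace Y. a < g (m y)} = f ` {x \<in> topspace X. g x \<in> {a<..}}"
      using m fx by (force simp: image_iff)
    moreover have "openin X {x \<in> topspace X. g x \<in> {a<..}}"
      by (rule openin_continuous_map_preimage[OF assms(6)]) auto
    ultimately show ?thesis using assms(5) by (simp add: open_map_def)
  qed
  moreover have "openin Y {y \<in> topspace Y. g (m y) < a}" for a
  proof -
    have "{y \<in> topspace Y. g (m y) < a} = topspace Y - {y \<in> topspace Y. a \<le> g (m y)}"
      by auto
    also have "{y \<in> topspace Y. a \<le> g (m y)} = f ` {x \<in> topspace X. g x \<in> {a..}}"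
      using m fx by (force simp: image_iff)
    finally have "{y \<in> topspace Y. g (m y) < a} = topspace Y - f ` {x \<in> topspace X. g x \<in> {a..}}" .
    moreover have "closedin X {x \<in> topspace X. g x \<in> {a..}}"
      by (rule closedin_continuous_map_preimage[OF assms(6)]) auto
    ultimately show ?thesis
      using continuous_imp_closed_map[OF assms(3,1,2)] by (simp add: closed_map_def openin_diff)
  qed
  ultimately have "continuous_map Y euclideanreal (\<lambda>y. g (m y))"
    by (simp add: continuous_map_upper_lower_semicontinuous_lt)
  then show thesis using that[of m] m fx by blast
qed

text \<open>While \<open>G\<close> is constant in time, the integral is the length of the interval
  times the mean of \<open>G a\<close>, a coordinate. Such multiples are continuous on all of
  \<open>HX X\<close> and add up over the cells.\<close>

lemma step_functional_extends:
  assumes "compact_space X" "finite S" "step_on S G" "\<And>t. continuous_map X euclideanreal (G t)"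
  obtains L where "continuous_map (HX X) euclideanreal L"
    "\<And>\<alpha>. \<alpha> \<in> HM X \<Longrightarrow> L (Hembed X \<alpha>) = integral {0..<1} (\<lambda>t. G t (\<alpha> t))"
proof -
  have "0 \<le> a \<longrightarrow> b \<le> 1 \<longrightarrow> (\<exists>L. continuous_map (HX X) euclideanreal L \<and>
    (\<forall>\<alpha>\<in>HM X. L (Hembed X \<alpha>) = integral {a..<b} (\<lambda>t. G t (\<alpha> t))))" if "a < b" for a b
    using assms(2) that
  proof (induction rule: breakpoint_induct)
    case (cell a b)
    show ?case
    proof (intro impI exI[of _ "\<lambda>z. (b - a) * z (HM_fun X (G a) a b)"] conjI ballI)
      assume ab: "0 \<le> a" "b \<le> 1"
      have s: "HM_fun X (G a) a b \<in> SHM X" using ab cell(1) assms(4) unfolding SHM_def by blast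
      show "continuous_map (HX X) euclideanreal (\<lambda>z. (b - a) * z (HM_fun X (G a) a b))"
        by (intro continuous_map_real_mult_left continuous_map_HX_eval assms s)
      fix \<alpha> assume \<alpha>: "\<alpha> \<in> HM X"
      have "integral {a..<b} (\<lambda>t. G t (\<alpha> t)) = integral {a..<b} (\<lambda>t. G a (\<alpha> t))"
        by (intro integral_cong) (metis step_on_cell[OF assms(3) cell(2)])
      also have "\<dots> = (b - a) * HM_fun X (G a) a b \<alpha>"
        by (intro integral_unique HM_fun_has_integral \<alpha> ab cell)
      finally show "(b - a) * Hembed X \<alpha> (HM_fun X (G a) a b) = integral {a..<b} (\<lambda>t. G t (\<alpha> t))"
        using s by (simp add: Hembed_def)
    qed
  next
    case (join a c b)
    show ?case
    proof (intro impI)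
      assume "0 \<le> a" "b \<le> 1"
      then obtain L M where L: "continuous_map (HX X) euclideanreal L"
          "\<forall>\<alpha>\<in>HM X. L (Hembed X \<alpha>) = integral {a..<c} (\<lambda>t. G t (\<alpha> t))"
        and M: "continuous_map (HX X) euclideanreal M"
          "\<forall>\<alpha>\<in>HM X. M (Hembed X \<alpha>) = integral {c..<b} (\<lambda>t. G t (\<alpha> t))"
        using join by auto
      have "integral {a..<b} (\<lambda>t. G t (\<alpha> t)) = integral {a..<c} (\<lambda>t. G t (\<alpha> t)) + integral {c..<b} (\<lambda>t. G t (\<alpha> t))"
        if "\<alpha> \<in> HM X" for \<alpha>
      proof -
        obtain T where T: "finite T" "step_on T \<alpha>" using HM_E[OF \<open>\<alpha> \<in> HM X\<close>] by metis
        show ?thesis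
          by (rule step_on_integral_join[OF _ step_on_eval[OF assms(3) T(2)]]) (use T assms join in auto)
      qed
      then show "\<exists>L. continuous_map (HX X) euclideanreal L \<and>
          (\<forall>\<alpha>\<in>HM X. L (Hembed X \<alpha>) = integral {a..<b} (\<lambda>t. G t (\<alpha> t)))"
        using L M by (intro exI[of _ "\<lambda>z. L z + M z"]) (auto intro: continuous_map_add)
    qed
  qed
  from this[of 0 1] show thesis using that by auto
qed

section \<open>Convex mixtures of step functions\<close>

lemma SHM_family_representation:
  assumes "finite I" "I \<subseteq> SHM X"
  obtains T G where "finite T" "\<And>s. s \<in> I \<Longrightarrow> step_on T (G s)"
    "\<And>s t. s \<in> I \<Longrightarrow> continuous_map X euclideanreal (G s t)"
    "\<And>s \<alpha>. s \<in> I \<Longrightarrow> \<alpha> \<in> HM X \<Longrightarrow> s \<alpha> = integral {0..<1} (\<lambda>t. G s t (\<alpha> t))"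
proof -
  define rep where "rep s S G \<longleftrightarrow> finite S \<and> step_on S G \<and> (\<forall>t. continuous_map X euclideanreal (G t)) \<and>
        (\<forall>\<alpha>\<in>HM X. s \<alpha> = integral {0..<1} (\<lambda>t. G t (\<alpha> t)))" for s S G
  have "\<exists>S G. rep s S G" if "s \<in> I" for s
    by (rule SHM_integral_representation[of s X]) (use assms(2) that in \<open>unfold rep_def, blast+\<close>)
  then obtain S G where SG: "\<And>s. s \<in> I \<Longrightarrow> rep s (S s) (G s)" by metis
  note rep = SG[unfolded rep_def]
  show thesis
  proof (rule that[of "\<Union>s\<in>I. S s" G])
    show "finite (\<Union>s\<in>I. S s)" using assms(1) rep[THEN conjunct1] by (rule finite_UN_I)
    show "step_on (\<Union>s\<in>I. S s) (G s)" if "s \<in> I" for s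
      using rep[OF that, THEN conjunct2, THEN conjunct1] by (rule step_on_mono) (use that in blast)
    show "continuous_map X euclideanreal (G s t)" if "s \<in> I" for s t
      using rep[OF that, THEN conjunct2, THEN conjunct2, THEN conjunct1] by (rule spec)
    show "s \<alpha> = integral {0..<1} (\<lambda>t. G s t (\<alpha> t))" if "s \<in> I" "\<alpha> \<in> HM X" for s \<alpha>
      using rep[OF that(1), THEN conjunct2, THEN conjunct2, THEN conjunct2] that(2) by (rule bspec)
  qed
qed

text \<open>Switching to \<open>\<alpha>'\<close> on the share \<open>\<tau>\<close> of every common
  cell realises the convex combination exactly. Since \<open>\<gamma>\<close> takes one of the two
  values at each time, it lies over \<open>\<beta>\<close> whenever both step functions do.\<close>

lemma HM_mix:
  assumes I: "finite I" "I \<subseteq> SHM X" and \<alpha>: "\<alpha> \<in> HM X" "\<alpha>' \<in> HM X" and \<tau>: "0 \<le> \<tau>" "\<tau> \<le> 1"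
  obtains \<gamma> where "\<gamma> \<in> HM X" "\<And>t. \<gamma> t \<in> {\<alpha> t, \<alpha>' t}"
    "\<And>s. s \<in> I \<Longrightarrow> s \<gamma> = (1 - \<tau>) * s \<alpha> + \<tau> * s \<alpha>'"
proof -
  obtain P G where P: "finite P" and SG: "\<And>s. s \<in> I \<Longrightarrow> step_on P (G s)"
    "\<And>s t. s \<in> I \<Longrightarrow> continuous_map X euclideanreal (G s t)"
    "\<And>s \<alpha>. s \<in> I \<Longrightarrow> \<alpha> \<in> HM X \<Longrightarrow> s \<alpha> = integral {0..<1} (\<lambda>t. G s t (\<alpha> t))"
    by (rule SHM_family_representation[OF I]) (rule that)
  obtain A where A: "finite A" "step_on A \<alpha>" "\<And>t. t \<in> {0..<1} \<Longrightarrow> \<alpha> t \<in> topspace X"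
      "\<And>t. t \<notin> {0..<1} \<Longrightarrow> \<alpha> t = undefined"
    using HM_E[OF \<alpha>(1)] by metis
  obtain A' where A': "finite A'" "step_on A' \<alpha>'" "\<And>t. t \<in> {0..<1} \<Longrightarrow> \<alpha>' t \<in> topspace X"
      "\<And>t. t \<notin> {0..<1} \<Longrightarrow> \<alpha>' t = undefined"
    using HM_E[OF \<alpha>(2)] by metis
  \<comment> \<open>The jumps of the integrands and of both step functions all enter, because
    \<open>\<kappa>\<close> yields the exact share only for functions with breakpoints in
    \<open>T\<close>.\<close>
  define T where "T = P \<union> A \<union> A'"
  have T: "finite T" using P A(1) A'(1) by (auto simp: T_def)
  obtain \<kappa> U where U: "finite U" "step_on U \<kappa>" and \<kappa>: "\<And>h :: real \<Rightarrow> real. step_on T h \<Longrightarrow>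
       integral {0..<1} (\<lambda>t. if \<kappa> t then h t else 0) = \<tau> * integral {0..<1} h"
    using thin_indicator_exists[OF T \<tau>, of 0 1] by auto
  define \<gamma> where "\<gamma> = (\<lambda>t. if \<kappa> t then \<alpha>' t else \<alpha> t)"
  have st: "step_on (T \<union> U) \<alpha>" "step_on (T \<union> U) \<alpha>'" "step_on (T \<union> U) \<kappa>"
    using A(2) A'(2) U(2) by (auto simp: T_def elim: step_on_mono)
  have "step_on (T \<union> U) \<gamma>" unfolding \<gamma>_def by (rule step_on_if[OF st(3,2,1)])
  then have \<gamma>: "\<gamma> \<in> HM X"
    unfolding HM_iff using T U A A' by (auto simp: \<gamma>_def intro!: exI[of _ "T \<union> U"])
  show thesis
  proof (rule that[OF \<gamma>])
    show "\<gamma> t \<in> {\<alpha> t, \<alpha>' t}" for t by (simp add: \<gamma>_def)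
    fix s assume s: "s \<in> I"
    have G: "step_on T (G s)" using SG(1)[OF s] by (auto simp: T_def elim: step_on_mono)
    have h: "step_on T (\<lambda>t. G s t (\<alpha> t))" "step_on T (\<lambda>t. G s t (\<alpha>' t))"
      using step_on_eval[OF G A(2)] step_on_eval[OF G A'(2)] by (auto simp: T_def elim: step_on_mono)
    have d: "step_on T (\<lambda>t. G s t (\<alpha>' t) - G s t (\<alpha> t))"
      by (rule step_on_compose2[OF h(2,1)])
    have d': "step_on (T \<union> U) (\<lambda>t. if \<kappa> t then G s t (\<alpha>' t) - G s t (\<alpha> t) else 0)"
      by (rule step_on_if[OF st(3) step_on_mono[OF d] step_on_const]) auto
    note int = step_on_integrable[OF T h(1)] step_on_integrable[OF T h(2)]
      step_on_integrable[OF _ d']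
    \<comment> \<open>The mixture is \<open>\<alpha>\<close> plus the difference at the switched
      times, to which the property of \<open>\<kappa>\<close> applies.\<close>
    have "s \<gamma> = integral {0..<1} (\<lambda>t. G s t (\<alpha> t) + (if \<kappa> t then G s t (\<alpha>' t) - G s t (\<alpha> t) else 0))"
      unfolding SG(3)[OF s \<gamma>] by (rule integral_cong) (simp add: \<gamma>_def)
    also have "\<dots> = s \<alpha> + \<tau> * integral {0..<1} (\<lambda>t. G s t (\<alpha>' t) - G s t (\<alpha> t))"
      unfolding SG(3)[OF s \<alpha>(1)] \<kappa>[OF d, symmetric] using int T U by (intro Henstock_Kurzweil_Integration.integral_add) auto
    also have "integral {0..<1} (\<lambda>t. G s t (\<alpha>' t) - G s t (\<alpha> t)) = s \<alpha>' - s \<alpha>"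
      unfolding SG(3)[OF s \<alpha>(1)] SG(3)[OF s \<alpha>(2)] using int by (intro Henstock_Kurzweil_Integration.integral_diff)
    finally show "s \<gamma> = (1 - \<tau>) * s \<alpha> + \<tau> * s \<alpha>'" by (simp add: algebra_simps)
  qed
qed

text \<open>Around each \<open>z0\<close> in \<open>W\<close> the set \<open>V\<close> is cut out by
  finitely many lower bounds on support functionals. Embedded step functions in \<open>V\<close> are
  handled by \<open>key\<close>, its other points by density and closedness of the image of a box
  \<open>C\<close>.\<close>

lemma open_map_Hlift:
  assumes X: "compact_space X" and Y: "compact_space Y" "Hausdorff_space Y"
    and f: "continuous_map X Y f" "f ` topspace X = topspace Y" "open_map X Y f"
  shows "open_map (HX X) (HX Y) (Hlift X Y f)"
  unfolding open_map_def
proof (intro allI impI)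
  fix W assume W: "openin (HX X) W"
  have "\<exists>V. openin (HX Y) V \<and> Hlift X Y f z0 \<in> V \<and> V \<subseteq> Hlift X Y f ` W" if z0W: "z0 \<in> W" for z0
  proof -
    have z0: "z0 \<in> topspace (HX X)" using W z0W openin_subset by blast
    obtain I \<epsilon> where I: "finite I" "I \<subseteq> SHM X" and \<epsilon>: "\<epsilon> > (0::real)"
      and nbhd: "\<And>z. z \<in> topspace (HX X) \<Longrightarrow> (\<And>s. s \<in> I \<Longrightarrow> \<bar>z s - z0 s\<bar> < \<epsilon>) \<Longrightarrow> z \<in> W"
      using HX_neighbourhood[OF X W z0W] by metis
    obtain T G where T: "finite T" and GT: "\<And>s. s \<in> I \<Longrightarrow> step_on T (G s)"
      and G_cont: "\<And>s t. s \<in> I \<Longrightarrow> continuous_map X euclideanreal (G s t)"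
      and G_int: "\<And>s \<alpha>. s \<in> I \<Longrightarrow> \<alpha> \<in> HM X \<Longrightarrow> s \<alpha> = integral {0..<1} (\<lambda>t. G s t (\<alpha> t))"
      by (rule SHM_family_representation[OF I]) (rule that)
    \<comment> \<open>The integral of \<open>g l\<close> along \<open>\<alpha>\<close> pairs the
      direction \<open>l\<close> with the coordinates of \<open>\<alpha>\<close>.\<close>
    define g where "g l = (\<lambda>t x. \<Sum>s\<in>I. l s * G s t x)" for l
    have g_step: "step_on T (g l)" for l
      unfolding step_on_def
    proof (intro allI impI)
      fix t u assume "t < u \<and> T \<inter> {t<..u} = {}"
      then have "G s t = G s u" if "s \<in> I" for s using GT[OF that] unfolding step_on_def by blast
      then show "g l t = g l u" by (simp add: g_def)
    qed
    have g_cont: "continuous_map X euclideanreal (g l t)" for l t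
      unfolding g_def by (intro continuous_map_sum I continuous_map_real_mult_left G_cont)
    have g_sum: "(\<Sum>s\<in>I. l s * s \<alpha>) = integral {0..<1} (\<lambda>t. g l t (\<alpha> t))" if \<alpha>: "\<alpha> \<in> HM X" for l \<alpha>
    proof -
      obtain A where A: "finite A" "step_on A \<alpha>" using HM_E[OF \<alpha>] by metis
      have "(\<lambda>t. G s t (\<alpha> t)) integrable_on {0..<1}" if "s \<in> I" for s
        by (rule step_on_integrable[OF _ step_on_eval[OF GT[OF that] A(2)]]) (use T A in auto)
      then have "integral {0..<1} (\<lambda>t. g l t (\<alpha> t)) = (\<Sum>s\<in>I. integral {0..<1} (\<lambda>t. l s * G s t (\<alpha> t)))"
        unfolding g_def using I(1) by (intro integral_sum integrable_on_mult_right) auto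
      then show ?thesis using G_int[OF _ \<alpha>] by simp
    qed
    \<comment> \<open>The maximiser is chosen as a function of \<open>h\<close> itself:
      \<open>m (g l t)\<close> then depends on time only through \<open>g l t\<close> and brings no
      new breakpoints.\<close>
    have "\<exists>m. (\<forall>y\<in>topspace Y. m y \<in> topspace X \<and> f (m y) = y) \<and> (\<forall>x\<in>topspace X. h x \<le> h (m (f x))) \<and>
        continuous_map Y euclideanreal (\<lambda>y. h (m y))" if "continuous_map X euclideanreal h" for h
      using fibre_maximum_continuous[OF X Y(2) f that] by metis
    then obtain m where m_fibre: "\<And>h y. continuous_map X euclideanreal h \<Longrightarrow> y \<in> topspace Y \<Longrightarrow>
          m h y \<in> topspace X \<and> f (m h y) = y"
      and m_max: "\<And>h x. continuous_map X euclideanreal h \<Longrightarrow> x \<in> topspace X \<Longrightarrow> h x \<le> h (m h (f x))"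
      and m_cont: "\<And>h. continuous_map X euclideanreal h \<Longrightarrow> continuous_map Y euclideanreal (\<lambda>y. h (m h y))"
      by metis
    define n where "n l = (\<lambda>t y. g l t (m (g l t) y))" for l
    have n_step: "step_on T (n l)" for l
      unfolding n_def by (rule step_on_compose[OF g_step])
    \<comment> \<open>\<open>L l\<close> is the support function in direction \<open>l\<close>,
      extended continuously from step functions to \<open>HX Y\<close>.\<close>
    have "\<exists>L. continuous_map (HX Y) euclideanreal L \<and>
        (\<forall>\<beta>\<in>HM Y. L (Hembed Y \<beta>) = integral {0..<1} (\<lambda>t. n l t (\<beta> t)))" for l
      using step_functional_extends[OF Y(1) T n_step, of l] m_cont[OF g_cont] unfolding n_def by metis
    then obtain L where L_cont: "\<And>l. continuous_map (HX Y) euclideanreal (L l)"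
      and L: "\<And>l \<beta>. \<beta> \<in> HM Y \<Longrightarrow> L l (Hembed Y \<beta>) = integral {0..<1} (\<lambda>t. n l t (\<beta> t))"
      by metis
    \<comment> \<open>Along a step function the fibrewise maximum dominates pointwise; density
      carries the bound to every \<open>z\<close>.\<close>
    have L_ge: "(\<Sum>s\<in>I. l s * z s) \<le> L l (Hlift X Y f z)" if "z \<in> topspace (HX X)" for l z
    proof (rule HX_le_by_density[OF X _ _ _ that])
      show "continuous_map (HX X) euclideanreal (\<lambda>z. \<Sum>s\<in>I. l s * z s)"
        using I by (intro continuous_map_sum continuous_map_real_mult_left continuous_map_HX_eval[OF X]) auto
      show "continuous_map (HX X) euclideanreal (\<lambda>z. L l (Hlift X Y f z))"
        using continuous_map_compose[OF continuous_map_Hlift[OF X Y(1) f(1)] L_cont] by (simp add: o_def)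
      fix \<alpha> assume \<alpha>: "\<alpha> \<in> HM X"
      obtain A where A: "finite A" "step_on A \<alpha>" "\<And>t. t \<in> {0..<1} \<Longrightarrow> \<alpha> t \<in> topspace X"
        using HM_E[OF \<alpha>] by metis
      have "(\<Sum>s\<in>I. l s * Hembed X \<alpha> s) = (\<Sum>s\<in>I. l s * s \<alpha>)"
        using I(2) by (intro sum.cong) (auto simp: Hembed_def)
      also have "\<dots> = integral {0..<1} (\<lambda>t. g l t (\<alpha> t))" by (rule g_sum[OF \<alpha>])
      also have "\<dots> \<le> integral {0..<1} (\<lambda>t. n l t (f (\<alpha> t)))"
      proof (rule integral_le)
        show "(\<lambda>t. g l t (\<alpha> t)) integrable_on {0..<1}"
          by (rule step_on_integrable[OF _ step_on_eval[OF g_step A(2)]]) (use T A in auto)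
        show "(\<lambda>t. n l t (f (\<alpha> t))) integrable_on {0..<1}"
          by (rule step_on_integrable[OF _ step_on_eval[OF n_step step_on_compose[OF A(2)]]]) (use T A in auto)
        show "g l t (\<alpha> t) \<le> n l t (f (\<alpha> t))" if "t \<in> {0..<1}" for t
          unfolding n_def by (rule m_max[OF g_cont A(3)[OF that]])
      qed
      also have "\<dots> = integral {0..<1} (\<lambda>t. n l t (Hpush f \<alpha> t))"
        by (rule integral_cong) (simp add: Hpush_def)
      also have "\<dots> = L l (Hlift X Y f (Hembed X \<alpha>))"
        unfolding Hlift_Hembed[OF f(1) \<alpha>] by (rule L[OF Hpush_in_HM[OF f(1) \<alpha>], symmetric])
      finally show "(\<Sum>s\<in>I. l s * Hembed X \<alpha> s) \<le> L l (Hlift X Y f (Hembed X \<alpha>))" .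
    qed
    have "\<exists>r. \<forall>\<alpha>\<in>HM X. \<bar>s \<alpha> - z0 s\<bar> \<le> r" if "s \<in> I" for s
    proof -
      have s: "s \<in> SHM X" using I(2) that by blast
      obtain p q where pq: "Hcoord_range X s = {p..q}" unfolding Hcoord_range_def Let_def by blast
      have "\<bar>s \<alpha> - z0 s\<bar> \<le> q - p" if "\<alpha> \<in> HM X" for \<alpha>
        using SHM_Hcoord_range[OF X s that] HX_range[OF z0 s] unfolding pq by auto
      then show ?thesis by blast
    qed
    then obtain r where r: "\<And>s \<alpha>. s \<in> I \<Longrightarrow> \<alpha> \<in> HM X \<Longrightarrow> \<bar>s \<alpha> - z0 s\<bar> \<le> r s" by metis
    \<comment> \<open>The 0 gives \<open>R \<ge> 0\<close> also for empty \<open>I\<close>.\<close>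
    define R where "R = Max (insert 0 (r ` I))"
    have R0: "R \<ge> 0" and rR: "\<And>s. s \<in> I \<Longrightarrow> r s \<le> R" using I(1) by (auto simp: R_def)
    have R: "\<bar>s \<alpha> - z0 s\<bar> \<le> R" if "s \<in> I" "\<alpha> \<in> HM X" for s \<alpha>
      using r[OF that] rR[OF that(1)] by simp
    \<comment> \<open>Halving \<open>\<epsilon>\<close> lets a closed box of radius \<open>e\<close>
      fit into \<open>W\<close>. The error \<open>\<rho>\<close> is spent half on the bounds
      defining \<open>V\<close> and half on the net, which costs at most
      \<open>card I * \<delta> * R\<close>; the 1 in \<open>q\<close> avoids division by
      zero.\<close>
    define e where "e = \<epsilon> / 2"
    define \<rho> where "\<rho> = e\<^sup>2 / 2"
    define q where "q = real (card I) * R + 1"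
    define \<delta> where "\<delta> = \<rho> / 2 / q"
    have e: "0 < e" "e < \<epsilon>" using \<epsilon> by (auto simp: e_def)
    then have \<rho>: "0 < \<rho>" "\<rho> < e\<^sup>2" by (auto simp: \<rho>_def)
    have pos: "q > 0" unfolding q_def using R0 by (intro add_nonneg_pos) auto
    then have \<delta>: "\<delta> > 0" using \<rho> by (simp add: \<delta>_def)
    have "\<delta> * (real (card I) * R) \<le> \<delta> * q" using \<delta> by (simp add: q_def)
    also have "\<dots> = \<rho> / 2" using pos by (simp add: \<delta>_def)
    finally have \<delta>': "real (card I) * (\<delta> * R) \<le> \<rho> / 2" by (simp add: algebra_simps)
    obtain \<Lambda> :: "(((real \<Rightarrow> 'a) \<Rightarrow> real) \<Rightarrow> real) set" where \<Lambda>: "finite \<Lambda>"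
      and net: "\<And>v. (\<And>i. i \<in> I \<Longrightarrow> \<bar>v i\<bar> \<le> R) \<Longrightarrow> \<exists>l\<in>\<Lambda>. \<forall>i\<in>I. \<bar>l i - v i\<bar> \<le> \<delta>"
      using finite_net_of_cube[OF I(1) \<delta>, of R] by metis
    define \<nu> where "\<nu> = Hlift X Y f z0"
    have \<nu>: "\<nu> \<in> topspace (HX Y)"
      using continuous_map_Hlift[OF X Y(1) f(1)] z0 by (auto simp: \<nu>_def continuous_map_def)
    define V where "V = (\<Inter>l\<in>\<Lambda>. {y \<in> topspace (HX Y). L l y \<in> {L l \<nu> - \<rho> / 2 <..}}) \<inter> topspace (HX Y)"
    have V: "openin (HX Y) V"
      unfolding V_def by (intro openin_INT \<Lambda> openin_continuous_map_preimage[OF L_cont]) simp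
    have \<nu>V: "\<nu> \<in> V" using \<nu> \<rho> by (auto simp: V_def)
    have key: "\<exists>\<alpha>\<in>HM X. Hpush f \<alpha> = \<beta> \<and> (\<forall>s\<in>I. \<bar>s \<alpha> - z0 s\<bar> \<le> e)"
      if \<beta>: "\<beta> \<in> HM Y" and \<beta>V: "Hembed Y \<beta> \<in> V" for \<beta>
    proof -
      obtain A where A: "finite A" "step_on A \<beta>" "\<And>t. t \<in> {0..<1} \<Longrightarrow> \<beta> t \<in> topspace Y"
        "\<And>t. t \<notin> {0..<1} \<Longrightarrow> \<beta> t = undefined"
        using HM_E[OF \<beta>] by metis
      \<comment> \<open>Taking the maximiser over \<open>\<beta> t\<close> at each time attains the
        support function in direction \<open>l\<close> exactly.\<close>
      define best where "best l = (\<lambda>t\<in>{0..<1}. m (g l t) (\<beta> t))" for l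
      have "step_on (T \<union> A) (\<lambda>t. m (g l t) (\<beta> t))" for l
        by (rule step_on_compose2[OF step_on_mono[OF g_step] step_on_mono[OF A(2)]]) auto
      then have best: "best l \<in> HM X" for l
        unfolding best_def using T A m_fibre[OF g_cont] by (intro restrict_HM[of "T \<union> A"]) auto
      have best_push: "Hpush f (best l) = \<beta>" for l
        unfolding best_def Hpush_def using A m_fibre[OF g_cont] by (auto simp: restrict_def fun_eq_iff)
      \<comment> \<open>Membership in \<open>V\<close> loses \<open>\<rho> / 2\<close> against
        \<open>L l \<nu>\<close>, which by \<open>L_ge\<close> is at least the pairing of
        \<open>l\<close> with \<open>z0\<close>.\<close>
      have best_sum: "(\<Sum>s\<in>I. l s * (s (best l) - z0 s)) \<ge> - (\<rho> / 2)" if "l \<in> \<Lambda>" for l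
      proof -
        have "(\<Sum>s\<in>I. l s * s (best l)) = integral {0..<1} (\<lambda>t. g l t (best l t))" by (rule g_sum[OF best])
        also have "\<dots> = integral {0..<1} (\<lambda>t. n l t (\<beta> t))"
          by (rule integral_cong) (simp add: best_def n_def)
        also have "\<dots> = L l (Hembed Y \<beta>)" by (rule L[OF \<beta>, symmetric])
        also have "\<dots> \<ge> L l \<nu> - \<rho> / 2" using \<beta>V that by (auto simp: V_def)
        finally have "L l \<nu> - \<rho> / 2 \<le> (\<Sum>s\<in>I. l s * s (best l))" .
        then show ?thesis using L_ge[OF z0, of l]
          by (simp add: \<nu>_def right_diff_distrib sum_subtractf)
      qed
      \<comment> \<open>Coordinate errors relative to \<open>z0\<close> of the step functions over
        \<open>\<beta>\<close>; a short vector in \<open>K\<close> is a preimage of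
        \<open>\<beta>\<close> close to \<open>z0\<close>.\<close>
      define K where "K = (\<lambda>\<alpha> s. s \<alpha> - z0 s) ` {\<alpha> \<in> HM X. Hpush f \<alpha> = \<beta>}"
      have "\<exists>u\<in>K. (\<Sum>s\<in>I. (u s)\<^sup>2) < e\<^sup>2"
      proof (rule small_vector_in_convex_family)
        show "K \<noteq> {}" using best best_push by (auto simp: K_def)
        show "0 \<le> \<rho>" "\<rho> < e\<^sup>2" using \<rho> by auto
        show "\<bar>u s\<bar> \<le> R" if "u \<in> K" "s \<in> I" for u s using that R by (auto simp: K_def)
      next
        fix u v \<tau> assume u: "u \<in> K" and v: "v \<in> K" and \<tau>: "0 \<le> \<tau>" "\<tau> \<le> (1::real)"
        obtain \<alpha> where \<alpha>: "\<alpha> \<in> HM X" "Hpush f \<alpha> = \<beta>" "u = (\<lambda>s. s \<alpha> - z0 s)" using u by (auto simp: K_def)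
        obtain \<alpha>' where \<alpha>': "\<alpha>' \<in> HM X" "Hpush f \<alpha>' = \<beta>" "v = (\<lambda>s. s \<alpha>' - z0 s)" using v by (auto simp: K_def)
        obtain \<gamma> where \<gamma>: "\<gamma> \<in> HM X" "\<And>t. \<gamma> t \<in> {\<alpha> t, \<alpha>' t}"
          "\<And>s. s \<in> I \<Longrightarrow> s \<gamma> = (1 - \<tau>) * s \<alpha> + \<tau> * s \<alpha>'"
          using HM_mix[OF I \<alpha>(1) \<alpha>'(1) \<tau>] by metis
        have "Hpush f \<gamma> t = \<beta> t" for t
          using fun_cong[OF \<alpha>(2), of t] fun_cong[OF \<alpha>'(2), of t] \<gamma>(2)[of t] by (auto simp: Hpush_def)
        then have "(\<lambda>s. s \<gamma> - z0 s) \<in> K" using \<gamma>(1) by (auto simp: K_def)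
        then show "\<exists>w\<in>K. \<forall>s\<in>I. w s = (1 - \<tau>) * u s + \<tau> * v s"
          by (rule bexI[rotated]) (simp add: \<gamma>(3) \<alpha>(3) \<alpha>'(3) algebra_simps)
      next
        fix u assume u: "u \<in> K"
        then have "\<bar>- u s\<bar> \<le> R" if "s \<in> I" for s using that R by (auto simp: K_def)
        \<comment> \<open>The direction \<open>l\<close> approximates \<open>- u\<close>, so
          \<open>best l\<close> pairs with \<open>u\<close> to at most \<open>\<rho> / 2\<close>
          plus the error of the net.\<close>
        then obtain l where l: "l \<in> \<Lambda>" "\<And>s. s \<in> I \<Longrightarrow> \<bar>l s + u s\<bar> \<le> \<delta>"
          using net[of "\<lambda>s. - u s"] by auto
        define v where "v s = s (best l) - z0 s" for s
        have "v \<in> K" unfolding v_def[abs_def] K_def using best best_push by auto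
        moreover have "(\<Sum>s\<in>I. (l s + u s) * v s) \<le> (\<Sum>s\<in>I. \<delta> * R)"
        proof (rule sum_mono)
          fix s assume s: "s \<in> I"
          have "\<bar>l s + u s\<bar> * \<bar>v s\<bar> \<le> \<delta> * R"
            using l(2)[OF s] R[OF s best] \<delta> by (intro mult_mono) (auto simp: v_def)
          then show "(l s + u s) * v s \<le> \<delta> * R" by (metis abs_le_D1 abs_mult)
        qed
        then have "(\<Sum>s\<in>I. u s * v s) \<le> \<rho>"
          using best_sum[OF l(1)] \<delta>' by (simp add: v_def[symmetric] distrib_right sum.distrib)
        ultimately show "\<exists>v\<in>K. (\<Sum>s\<in>I. u s * v s) \<le> \<rho>" by blast
      qed
      then obtain \<alpha> where \<alpha>: "\<alpha> \<in> HM X" "Hpush f \<alpha> = \<beta>" "(\<Sum>s\<in>I. (s \<alpha> - z0 s)\<^sup>2) < e\<^sup>2"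
        by (auto simp: K_def)
      have "\<bar>s \<alpha> - z0 s\<bar> \<le> e" if "s \<in> I" for s
      proof -
        have "(s \<alpha> - z0 s)\<^sup>2 \<le> (\<Sum>s\<in>I. (s \<alpha> - z0 s)\<^sup>2)"
          by (rule member_le_sum[OF that]) (use I in auto)
        then have "\<bar>s \<alpha> - z0 s\<bar>\<^sup>2 \<le> e\<^sup>2" using \<alpha>(3) by simp
        then show ?thesis by (rule power2_le_imp_le) (use e in simp)
      qed
      then show ?thesis using \<alpha> by blast
    qed
    \<comment> \<open>For empty \<open>I\<close> the inner intersection is everything, so
      \<open>topspace (HX X)\<close> is intersected in.\<close>
    define C where "C = topspace (HX X) \<inter> (\<Inter>s\<in>I. {z \<in> topspace (HX X). z s \<in> {z0 s - e .. z0 s + e}})"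
    have "closedin (HX X) {z \<in> topspace (HX X). z s \<in> {z0 s - e .. z0 s + e}}" if "s \<in> I" for s
      by (rule closedin_continuous_map_preimage[OF continuous_map_HX_eval[OF X]]) (use that I(2) in auto)
    then have C_closed: "closedin (HX X) C"
      unfolding C_def by (cases "I = {}") (auto intro!: closedin_Int closedin_INT simp del: atLeastAtMost_iff)
    have CW: "C \<subseteq> W"
    proof
      fix z assume z: "z \<in> C"
      then have "\<bar>z s - z0 s\<bar> < \<epsilon>" if "s \<in> I" for s using that e by (fastforce simp: C_def)
      then show "z \<in> W" using nbhd z by (auto simp: C_def)
    qed
    have D: "closedin (HX Y) (Hlift X Y f ` C)"
      using continuous_imp_closed_map[OF continuous_map_Hlift[OF X Y(1) f(1)] compact_space_HX Hausdorff_space_HX] C_closed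
      by (simp add: closed_map_def)
    have "V \<subseteq> Hlift X Y f ` C"
    proof (rule ccontr)
      assume "\<not> V \<subseteq> Hlift X Y f ` C"
      \<comment> \<open>What \<open>V\<close> has outside the closed image is open; if nonempty, it
        contains an embedded step function, against \<open>key\<close>.\<close>
      then have "V - Hlift X Y f ` C \<noteq> {}" "openin (HX Y) (V - Hlift X Y f ` C)"
        using V D by (auto intro: openin_diff)
      then obtain \<beta> where \<beta>: "\<beta> \<in> HM Y" "Hembed Y \<beta> \<in> V" "Hembed Y \<beta> \<notin> Hlift X Y f ` C"
        using HX_dense[OF Y(1)] unfolding dense_intersects_open by blast
      obtain \<alpha> where \<alpha>: "\<alpha> \<in> HM X" "Hpush f \<alpha> = \<beta>" "\<forall>s\<in>I. \<bar>s \<alpha> - z0 s\<bar> \<le> e"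
        using key[OF \<beta>(1,2)] by blast
      have "Hembed X \<alpha> s = s \<alpha>" if "s \<in> I" for s using I(2) that by (auto simp: Hembed_def)
      then have "Hembed X \<alpha> \<in> C"
        using \<alpha>(3) Hembed_in_HX[OF X \<alpha>(1)] by (auto simp: C_def abs_le_iff algebra_simps)
      then show False using \<beta>(3) Hlift_Hembed[OF f(1) \<alpha>(1)] \<alpha>(2) by (metis imageI)
    qed
    then show ?thesis using V \<nu>V CW unfolding \<nu>_def by blast
  qed
  then show "openin (HX Y) (Hlift X Y f ` W)"
    by (subst openin_subopen) blast
qed

section \<open>Openness of $f$ for open $Hf$\<close>

text \<open>On constant maps each mean of \<open>\<phi>\<close> is the value of
  \<open>\<phi>\<close>, so every component is continuous on \<open>X\<close>.\<close>

lemma Hembed_const_continuous: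
  assumes "compact_space X"
  shows "continuous_map X (HX X) (\<lambda>x. Hembed X (\<lambda>t\<in>{0..<1}. x))"
  unfolding HX_eq_subtopology[OF assms]
proof (rule continuous_map_into_subtopology)
  have "continuous_map X euclideanreal (\<lambda>x. s (\<lambda>t\<in>{0..<1}. x))" if s: "s \<in> SHM X" for s
  proof -
    obtain \<phi> a b where s: "s = HM_fun X \<phi> a b" "continuous_map X euclideanreal \<phi>" "0 \<le> a" "a < b" "b \<le> 1"
      using s unfolding SHM_def by auto
    show ?thesis
      unfolding s(1) by (rule continuous_map_eq[OF s(2)]) (rule HM_fun_const[OF _ s(3-), symmetric])
  qed
  then show "continuous_map X (product_topology (\<lambda>s. euclideanreal) (SHM X)) (\<lambda>x. Hembed X (\<lambda>t\<in>{0..<1}. x))"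
    by (auto simp: continuous_map_componentwise Hembed_def)
  show "(\<lambda>x. Hembed X (\<lambda>t\<in>{0..<1}. x)) \<in> topspace X \<rightarrow>
      product_topology (\<lambda>s. euclideanreal) (SHM X) closure_of (Hembed X ` HM X)"
    unfolding topspace_HX[OF assms, symmetric]
    by (intro Pi_I Hembed_in_HX[OF assms] restrict_HM[where S="{}"] step_on_const) auto
qed

text \<open>A point \<open>z\<close> of \<open>W\<close> over a constant map need not come from a
  step function, so no point of the fibre can be read off from it. Instead, if the fibre of
  \<open>y\<close> missed \<open>U\<close>, a second Urysohn function \<open>\<psi>\<close> would
  bound \<open>\<phi>\<close> by \<open>1/2 + \<psi> \<circ> f\<close>. This passes to means on
  \<open>HX X\<close> and contradicts the bound defining \<open>W\<close>.\<close>

lemma open_map_Hlift_imp_open_map: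
  assumes X: "compact_space X" "Hausdorff_space X" and Y: "compact_space Y" "Hausdorff_space Y"
    and f: "continuous_map X Y f" and op: "open_map (HX X) (HX Y) (Hlift X Y f)"
  shows "open_map X Y f"
  unfolding open_map_def
proof (intro allI impI)
  fix U assume U: "openin X U"
  have "\<exists>V. openin Y V \<and> f x0 \<in> V \<and> V \<subseteq> f ` U" if x0: "x0 \<in> U" for x0
  proof -
    have x0X: "x0 \<in> topspace X" using U x0 openin_subset by blast
    have "normal_space X" using X compact_Hausdorff_or_regular_imp_normal_space by blast
    then obtain \<phi> where \<phi>: "continuous_map X (top_of_set {0..1::real}) \<phi>" "\<phi> ` (topspace X - U) \<subseteq> {0}" "\<phi> ` {x0} \<subseteq> {1}"
      using Urysohn_lemma[of X "topspace X - U" "{x0}" 0 1] U x0 x0X X(2)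
      by (auto simp: closedin_Hausdorff_sing_eq)
    have \<phi>c: "continuous_map X euclideanreal \<phi>" and \<phi>1: "\<And>x. x \<in> topspace X \<Longrightarrow> \<phi> x \<le> 1"
      using \<phi>(1) by (auto simp: continuous_map_in_subtopology Pi_iff)
    let ?s = "HM_fun X \<phi> 0 1"
    have s: "?s \<in> SHM X" using \<phi>c by (force simp: SHM_def)
    define W where "W = {z \<in> topspace (HX X). z ?s \<in> {1/2<..}}"
    have W: "openin (HX X) W" unfolding W_def
      by (rule openin_continuous_map_preimage[OF continuous_map_HX_eval[OF X(1) s]]) simp
    define V where "V = {y \<in> topspace Y. Hembed Y (\<lambda>t\<in>{0..<1}. y) \<in> Hlift X Y f ` W}"
    have V: "openin Y V" unfolding V_def
      by (rule openin_continuous_map_preimage[OF Hembed_const_continuous[OF Y(1)]])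
        (use op W in \<open>simp add: open_map_def\<close>)
    have cHM: "(\<lambda>t\<in>{0..<1}. x0) \<in> HM X"
      by (rule restrict_HM[where S="{}"]) (use x0X step_on_const in auto)
    have "Hembed X (\<lambda>t\<in>{0..<1}. x0) \<in> W"
      using Hembed_in_HX[OF X(1) cHM] s HM_fun_const[OF x0X, of 0 1 \<phi>] \<phi>(3) by (simp add: W_def Hembed_def)
    moreover have "Hpush f (\<lambda>t\<in>{0..<1}. x0) = (\<lambda>t\<in>{0..<1}. f x0)" by (auto simp: Hpush_def restrict_def fun_eq_iff)
    ultimately have "f x0 \<in> V"
      using Hlift_Hembed[OF f cHM] continuous_map_image_subset_topspace[OF f] x0X by (auto simp: V_def image_iff intro!: bexI)
    moreover have "V \<subseteq> f ` U"
    proof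
      fix y assume "y \<in> V"
      then obtain z where y: "y \<in> topspace Y" and z: "z \<in> W" and zy: "Hlift X Y f z = Hembed Y (\<lambda>t\<in>{0..<1}. y)"
        by (auto simp: V_def)
      show "y \<in> f ` U"
      proof (rule ccontr)
        assume nU: "y \<notin> f ` U"
        \<comment> \<open>This closed part of \<open>U\<close> has a closed image that avoids
          \<open>y\<close>, so \<open>\<psi>\<close> can separate the two.\<close>
        let ?E = "{x \<in> topspace X. \<phi> x \<in> {1/2..}}"
        have "closedin X ?E" by (rule closedin_continuous_map_preimage[OF \<phi>c]) simp
        then have "closedin Y (f ` ?E)"
          using continuous_imp_closed_map[OF f X(1) Y(2)] by (simp add: closed_map_def)
        moreover have "?E \<subseteq> U" using \<phi>(2) by force
        then have "y \<notin> f ` ?E" using nU by blast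
        moreover have "normal_space Y" using Y compact_Hausdorff_or_regular_imp_normal_space by blast
        ultimately obtain \<psi> where \<psi>: "continuous_map Y (top_of_set {0..1::real}) \<psi>" "\<psi> ` {y} \<subseteq> {0}" "\<psi> ` f ` ?E \<subseteq> {1}"
          using Urysohn_lemma[of Y "{y}" "f ` ?E" 0 1] y Y(2)
          by (auto simp: closedin_Hausdorff_sing_eq)
        have \<psi>c: "continuous_map Y euclideanreal \<psi>" and \<psi>0: "\<And>y. y \<in> topspace Y \<Longrightarrow> 0 \<le> \<psi> y"
          using \<psi>(1) by (auto simp: continuous_map_in_subtopology Pi_iff)
        let ?r = "HM_fun X (\<psi> \<circ> f) 0 1"
        have r: "?r \<in> SHM X" using continuous_map_compose[OF f \<psi>c] by (force simp: SHM_def)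
        have rY: "HM_fun Y \<psi> 0 1 \<in> SHM Y" using \<psi>c by (force simp: SHM_def)
        \<comment> \<open>On \<open>?E\<close> the second term is 1, which bounds
          \<open>\<phi>\<close>; off it \<open>\<phi>\<close> is below 1/2 and \<open>\<psi>\<close>
          is non-negative.\<close>
        have pw: "\<phi> x \<le> 1/2 + (\<psi> \<circ> f) x" if "x \<in> topspace X" for x
        proof (cases "x \<in> ?E")
          case True
          then have "\<psi> (f x) = 1" using \<psi>(3) by blast
          then show ?thesis using \<phi>1[OF that] by simp
        next
          case False
          then show ?thesis using that \<psi>0[of "f x"] continuous_map_image_subset_topspace[OF f] by auto
        qed
        have zX: "z \<in> topspace (HX X)" using z by (simp add: W_def)
        have "z ?s \<le> 1/2 + z ?r"
        proof (rule HX_le_by_density[OF X(1) continuous_map_HX_eval[OF X(1) s] _ _ zX])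
          show "continuous_map (HX X) euclideanreal (\<lambda>z. 1/2 + z ?r)"
            by (intro continuous_map_add continuous_map_HX_eval[OF X(1) r]) auto
          fix \<alpha> assume \<alpha>: "\<alpha> \<in> HM X"
          have inX: "\<And>t. t \<in> {0..<1} \<Longrightarrow> \<alpha> t \<in> topspace X" using HM_E[OF \<alpha>] by metis
          have "((\<lambda>t. \<phi> (\<alpha> t)) has_integral ?s \<alpha>) {0..<1}"
            using HM_fun_has_integral[OF \<alpha>, of 0 1 \<phi>] by simp
          moreover have "((\<lambda>t. 1/2 + (\<psi> \<circ> f) (\<alpha> t)) has_integral 1/2 + ?r \<alpha>) {0..<1}"
            using has_integral_add[OF has_integral_const_Ico[of 0 1 "\<lambda>_. 1/2" "1/2"] HM_fun_has_integral[OF \<alpha>, of 0 1 "\<psi> \<circ> f"]] by simp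
          ultimately have "?s \<alpha> \<le> 1/2 + ?r \<alpha>"
            by (rule has_integral_le) (use pw inX in auto)
          then show "Hembed X \<alpha> ?s \<le> 1/2 + Hembed X \<alpha> ?r" using s r by (simp add: Hembed_def)
        qed
        \<comment> \<open>This coordinate of \<open>z\<close> is visible in its image, the embedded
          constant map at \<open>y\<close>, where the mean of \<open>\<psi>\<close> is
          \<open>\<psi> y\<close>.\<close>
        also have "z ?r = Hlift X Y f z (HM_fun Y \<psi> 0 1)"
          using rY Hpull_HM_fun[OF f, of 0 1 \<psi>] by (simp add: Hlift_def)
        also have "\<dots> = \<psi> y"
          using rY HM_fun_const[OF y, of 0 1 \<psi>] by (simp add: zy Hembed_def)
        also have "\<psi> y = 0" using \<psi>(2) by simp
        finally show False using z by (simp add: W_def)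
      qed
    qed
    ultimately show ?thesis using V by blast
  qed
  then show "openin Y (f ` U)" by (subst openin_subopen) blast
qed

theorem theorem1p1:
  fixes X :: "'a topology" and Y :: "'b topology" and f :: "'a \<Rightarrow> 'b"
  assumes "compact_space X" and "Hausdorff_space X"
    and "compact_space Y" and "Hausdorff_space Y"
    and "continuous_map X Y f" and "f ` topspace X = topspace Y"
  shows "open_map (HX X) (HX Y) (Hmap X Y f) \<longleftrightarrow> open_map X Y f"
proof -
  \<comment> \<open>Open sets lie in \<open>topspace (HX X)\<close>, where both maps agree, so their
    images coincide.\<close>
  have "open_map (HX X) (HX Y) (Hmap X Y f) \<longleftrightarrow> open_map (HX X) (HX Y) (Hlift X Y f)"
    unfolding open_map_def using Hmap_eq_Hlift[OF assms(1,3,5)]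
    by (metis (no_types, lifting) image_cong openin_subset subsetD)
  then show ?thesis
    using open_map_Hlift[OF assms(1,3,4,5,6)] open_map_Hlift_imp_open_map[OF assms(1-5)] by blast
qed

end
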